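(* Let $k\in\mathbb{N}$, $k\ge1$, $z>0$, $\beta\ge0$, and let $\Phi:\mathbb{R}^d\to\mathbb{R}$ be measurable with $\|\Phi\|_\infty=\sup_{x}|\Phi(x)|<\infty$. Let $\Gamma$ be a stationary Gibbs point process in $\mathbb{R}^d$ with Papangelou intensity $\lambda^*(x,\gamma)=z\exp\{-\beta h(x,\gamma)\}$, where $$h(x,\gamma)=\sum_{y\in V^k(x,\gamma)}\Phi(x-y)+\sum_{y\in\gamma}\mathbf{1}\{x\in V^k(y,\gamma\cup\{x\})\}\big[\Phi(y-x)-\Phi(y-v^k(y,\gamma))\big].$$ Then $\Gamma$ is not hyperuniform.
   Context: Points are unmarked. $\mathbf{N}$ is the set of locally finite subsets of $\mathbb{R}^d$, with the $\sigma$-field generated by the counts of points in Borel sets; $N_\Lambda(\gamma)$ is the number of points of $\gamma$ in $\Lambda$, and $|\cdot|$ is Lebesgue measure. For $\gamma\in\mathbf{N}$ and $x\in\mathbb{R}^d$, $v^i(x,\gamma)$ is the $i$-th nearest neighbour of $x$ among the points of $\gamma\setminus\{x\}$ (ties broken by lexicographic order), and $V^k(x,\gamma)$ is the set of the first $k$ nearest neighbours of $x$ in $\gamma\setminus\{x\}$ (all points of $\gamma\setminus\{x\}$ if there are fewer than $k$). If $v^k(y,\gamma)$ does not exist, the term $\Phi(y-v^k(y,\gamma))$ is taken to be $0$. A point process $\Gamma$ is a probability measure on $\mathbf{N}$ (also a random configuration with that law); it is stationary if its law is translation invariant. $\Gamma$ is a Gibbs point process with Papangelou intensity $\lambda^*$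 if for all nonnegative measurable $f$, $$\int_{\mathbf{N}}\sum_{x\in\gamma}f(x,\gamma\setminus\{x\})\,\Gamma(d\gamma)=\int_{\mathbf{N}}\int_{\mathbb{R}^d} f(x,\gamma)\lambda^*(x,\gamma)\,dx\,\Gamma(d\gamma).$$ A stationary point process $\Gamma$ is hyperuniform if $\lim \mathrm{Var}(N_\Lambda(\Gamma))/|\Lambda|=0$ along any increasing sequence of bounded Borel sets $\Lambda_1\subseteq\Lambda_2\subseteq\dots$ tending to the whole space $\mathbb{R}^d$. *)

theory Defs
  imports "HOL-Probability.Probability" "HOL-Library.Fun_Lexorder"
begin

definition locally_finite_sets :: "'a::metric_space set set" where
  "locally_finite_sets = {\<gamma>. \<forall>B. bounded B \<longrightarrow> finite (\<gamma> \<inter> B)}"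

definition num_points :: "'a set \<Rightarrow> 'a set \<Rightarrow> ennreal" where
  "num_points \<Lambda> \<gamma> = emeasure (count_space UNIV) (\<gamma> \<inter> \<Lambda>)"

definition config_space :: "'a::euclidean_space set measure" where
  "config_space = sigma locally_finite_sets
     {num_points B -` A \<inter> locally_finite_sets | A B. A \<in> sets borel \<and> B \<in> sets borel}"

definition point_process :: "'a::euclidean_space set measure \<Rightarrow> bool" where
  "point_process \<Gamma> \<longleftrightarrow> prob_space \<Gamma> \<and> sets \<Gamma> = sets config_space"

definition stationary :: "'a::euclidean_space set measure \<Rightarrow> bool" where
  "stationary \<Gamma> \<longleftrightarrow> (\<forall>a. distr \<Gamma> config_space (\<lambda>\<gamma>. (+) a ` \<gamma>) = \<Gamma>)"

(* The sum over the (possibly infinite) configuration is the integral against counting measure. *)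
definition gibbs_process ::
    "'a::euclidean_space set measure \<Rightarrow> ('a \<Rightarrow> 'a set \<Rightarrow> ennreal) \<Rightarrow> bool" where
  "gibbs_process \<Gamma> lam \<longleftrightarrow> point_process \<Gamma> \<and>
     (\<forall>f :: 'a \<times> 'a set \<Rightarrow> ennreal. f \<in> borel_measurable (borel \<Otimes>\<^sub>M config_space) \<longrightarrow>
        (\<integral>\<^sup>+\<gamma>. (\<integral>\<^sup>+x. f (x, \<gamma> - {x}) \<partial>count_space \<gamma>) \<partial>\<Gamma>) =
        (\<integral>\<^sup>+\<gamma>. (\<integral>\<^sup>+x. f (x, \<gamma>) * lam x \<gamma> \<partial>lborel) \<partial>\<Gamma>))"

(* Takes values in [0, infinity], so that an infinite variance is not read as 0. If the mean itself
   is infinite, the Bochner integral is 0 and the value is still infinity. For bounded L the count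
   is finite, so enn2real loses nothing. *)
definition count_variance :: "'a::euclidean_space set measure \<Rightarrow> 'a set \<Rightarrow> ennreal" where
  "count_variance \<Gamma> L =
     (\<integral>\<^sup>+\<gamma>. ennreal ((enn2real (num_points L \<gamma>) - (\<integral>\<omega>. enn2real (num_points L \<omega>) \<partial>\<Gamma>))\<^sup>2) \<partial>\<Gamma>)"

definition hyperuniform :: "'a::euclidean_space set measure \<Rightarrow> bool" where
  "hyperuniform \<Gamma> \<longleftrightarrow>
     (\<forall>L :: nat \<Rightarrow> 'a set.
        incseq L \<and> (\<forall>n. bounded (L n) \<and> L n \<in> sets borel) \<and> (\<Union>n. L n) = UNIV \<longrightarrow>
        (\<lambda>n. count_variance \<Gamma> (L n) / emeasure lborel (L n)) \<longlonglongrightarrow> 0)"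

(* less_fun is the lexicographic order of the coordinates; it needs the index type to be ordered. *)
definition closer :: "real ^ 'n::{finite,linorder} \<Rightarrow> real ^ 'n::{finite,linorder} \<Rightarrow> real ^ 'n::{finite,linorder} \<Rightarrow> bool" where
  "closer x y w \<longleftrightarrow>
     dist x y < dist x w \<or> dist x y = dist x w \<and> less_fun (vec_nth y) (vec_nth w)"

(* For locally finite configurations only finitely many points precede a given one,
   so the cardinality counts them. *)
definition is_neighbour ::
    "nat \<Rightarrow> real ^ 'n::{finite,linorder} \<Rightarrow> (real ^ 'n::{finite,linorder}) set \<Rightarrow> real ^ 'n::{finite,linorder} \<Rightarrow> bool" where
  "is_neighbour i x \<gamma> y \<longleftrightarrow>
     y \<in> \<gamma> - {x} \<and> card {w \<in> \<gamma> - {x}. closer x w y} + 1 = i"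

definition neighbour ::
    "nat \<Rightarrow> real ^ 'n::{finite,linorder} \<Rightarrow> (real ^ 'n::{finite,linorder}) set \<Rightarrow> (real ^ 'n::{finite,linorder}) option" where
  "neighbour i x \<gamma> =
     (if \<exists>y. is_neighbour i x \<gamma> y then Some (THE y. is_neighbour i x \<gamma> y) else None)"

definition neighbours ::
    "nat \<Rightarrow> real ^ 'n::{finite,linorder} \<Rightarrow> (real ^ 'n::{finite,linorder}) set \<Rightarrow> (real ^ 'n::{finite,linorder}) set" where
  "neighbours k x \<gamma> = {y. \<exists>i\<in>{1..k}. neighbour i x \<gamma> = Some y}"

(* In the second sum only finitely many terms are nonzero: in a cone with apex x and opening angle
   below pi/3 at most k points y can have x among their k nearest neighbours. *)
definition local_energy ::
    "nat \<Rightarrow> (real ^ 'n::{finite,linorder} \<Rightarrow> real) \<Rightarrow> real ^ 'n::{finite,linorder} \<Rightarrow> (real ^ 'n::{finite,linorder}) set \<Rightarrow> real" where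
  "local_energy k \<Phi> x \<gamma> =
     (\<Sum>y\<in>neighbours k x \<gamma>. \<Phi> (x - y)) +
     (\<Sum>\<^sub>\<infinity>y\<in>\<gamma>. of_bool (x \<in> neighbours k y (insert x \<gamma>)) *
        (\<Phi> (y - x) - (case neighbour k y \<gamma> of None \<Rightarrow> 0 | Some w \<Rightarrow> \<Phi> (y - w))))"

end

theory Submission imports Defs begin

text \<open>
  The number of points in a large region fluctuates at least as much as a sum of many uncorrelated
  local contributions, which forces its variance to grow like the volume. The contributions come
  from small balls that are screened from the rest of space.

  Around a centre \<open>v\<close> consider a core \<open>ball v 1\<close> and a neighbourhood \<open>ball v 16\<close>. If finitely many unit
  balls that surround the core at distance \<open>5\<close> contain more than \<open>k\<close> points each, then a point \<open>x\<close> in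
  the core is never among the \<open>k\<close> nearest neighbours of a distant point, and points near the core find
  their \<open>k\<close> nearest neighbours inside the neighbourhood. Hence the energy of \<open>x\<close> depends only on the
  points in the neighbourhood (\<open>local_energy_screened\<close>), and an upper bound \<open>K\<close> on the number of points
  around the core bounds it (\<open>abs_local_energy_le\<close>). Write \<open>W\<close> for the integral of the intensity over the
  core in such a situation, and let the score of \<open>v\<close> be
  \<open>1\<close> if the core is screened and contains one point, \<open>- W\<close> if it is screened and empty, and \<open>0\<close>
  otherwise. The score is bounded and is a function of the points in the neighbourhood of \<open>v\<close>.

  The Georgii--Nguyen--Zessin equation says exactly that the score integrates to zero against every
  nonnegative integrable function that ignores the points of the core (\<open>integral_score_mult_eq_0\<close>).
  Three consequences follow: scores of disjoint neighbourhoods are uncorrelated; each score has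
  mean zero; and its covariance with the number of points in a region that contains the core is the
  probability \<open>m\<close> that the core is screened with one point in it, because only the point in the core
  contributes. By stationarity \<open>m\<close> is the same for all centres. A cube of side
  proportional to \<open>2 n + 1\<close> holds a number \<open>N\<close> of disjoint neighbourhoods proportional to its volume,
  so a Cauchy--Schwarz argument with the sum of the scores bounds the variance below by a constant
  times \<open>N\<close> (\<open>second_moment_ge_orthogonal\<close>).

  It remains to see that \<open>m > 0\<close>. As the intensity is strictly positive, the same equation shows that
  adding a point in a set of positive volume, or removing one, leads from events of positive
  probability to events of positive probability. Emptying the neighbourhood and then filling the
  surrounding balls and the core point by point gives \<open>m > 0\<close> for a suitable \<open>K\<close>
  (\<open>possibly_single_screened\<close>). All of this needs the energy to be jointly measurable in the point and
  the configuration, which is obtained from a general measurability result for sums over the points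
  of a configuration (\<open>measurable_sum_over_config\<close>).
\<close>

section \<open>Configurations and their counts\<close>

lemma space_config_space [simp]: "space config_space = locally_finite_sets"
  unfolding config_space_def by (rule space_measure_of) auto

lemma measurable_num_points [measurable]:
  assumes "B \<in> sets borel"
  shows "num_points B \<in> borel_measurable config_space"
proof (rule measurableI)
  fix A :: "ennreal set" assume "A \<in> sets borel"
  then have "num_points B -` A \<inter> locally_finite_sets \<in>
      sigma_sets locally_finite_sets {num_points B -` A \<inter> locally_finite_sets | A B. A \<in> sets borel \<and> B \<in> sets borel}"
    using assms by blast
  then show "num_points B -` A \<inter> space config_space \<in> sets config_space"
    by (subst space_config_space, unfold config_space_def, subst sets_measure_of) auto
qed simp

lemma measurable_config_spaceI:
  fixes g :: "'b \<Rightarrow> 'a::euclidean_space set"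
  assumes "\<And>\<omega>. \<omega> \<in> space M \<Longrightarrow> g \<omega> \<in> locally_finite_sets"
    and "\<And>B. B \<in> sets borel \<Longrightarrow> (\<lambda>\<omega>. num_points B (g \<omega>)) \<in> borel_measurable M"
  shows "g \<in> measurable M config_space"
  unfolding config_space_def
proof (rule measurable_measure_of)
  fix y :: "'a set set" assume "y \<in> {num_points B -` A \<inter> locally_finite_sets | A B. A \<in> sets borel \<and> B \<in> sets borel}"
  then obtain A :: "ennreal set" and B :: "'a set" where y: "y = num_points B -` A \<inter> locally_finite_sets"
    and A: "A \<in> sets borel" and B: "B \<in> sets borel" by blast
  have "g -` y \<inter> space M = (\<lambda>\<omega>. num_points B (g \<omega>)) -` A \<inter> space M"
    using assms(1) by (auto simp: y)
  then show "g -` y \<inter> space M \<in> sets M"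
    using measurable_sets[OF assms(2)[OF B] A] by simp
qed (use assms(1) in auto)

lemma finite_locally_finite_Int:
  assumes "\<gamma> \<in> locally_finite_sets" and "bounded B"
  shows "finite (\<gamma> \<inter> B)"
  using assms by (simp add: locally_finite_sets_def)

lemma num_points_eq_card:
  "finite (\<gamma> \<inter> B) \<Longrightarrow> num_points B \<gamma> = of_nat (card (\<gamma> \<inter> B))"
  by (simp add: num_points_def emeasure_count_space)

lemma num_points_eq_0_iff: "num_points B \<gamma> = 0 \<longleftrightarrow> \<gamma> \<inter> B = {}"
  by (auto simp: num_points_def emeasure_count_space_eq_0)

lemma num_points_eq_1_iff: "num_points B \<gamma> = 1 \<longleftrightarrow> (\<exists>x. \<gamma> \<inter> B = {x})"
proof (cases "finite (\<gamma> \<inter> B)")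
  case True
  then show ?thesis
    by (metis num_points_eq_card card_1_singleton_iff One_nat_def of_nat_eq_1_iff)
next
  case False
  then show ?thesis by (auto simp: num_points_def emeasure_count_space)
qed

lemma of_nat_le_num_points_iff:
  "finite (\<gamma> \<inter> B) \<Longrightarrow> of_nat n \<le> num_points B \<gamma> \<longleftrightarrow> n \<le> card (\<gamma> \<inter> B)"
  by (simp add: num_points_eq_card)

lemma num_points_cong: "\<gamma> \<inter> B = \<gamma>' \<inter> B \<Longrightarrow> num_points B \<gamma> = num_points B \<gamma>'"
  by (simp add: num_points_def)

lemma num_points_insert:
  assumes "x \<notin> \<gamma>"
  shows "num_points B (insert x \<gamma>) = num_points B \<gamma> + indicator B x"
proof (cases "x \<in> B")
  case True
  then show ?thesis using assms
    by (cases "finite (\<gamma> \<inter> B)") (auto simp: num_points_def emeasure_count_space)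
qed (simp add: num_points_def)

lemma locally_finite_subset:
  "\<gamma> \<in> locally_finite_sets \<Longrightarrow> \<gamma>' \<subseteq> \<gamma> \<Longrightarrow> \<gamma>' \<in> locally_finite_sets"
  by (auto simp: locally_finite_sets_def intro: finite_subset[of "\<gamma>' \<inter> _" "\<gamma> \<inter> _"])

lemma locally_finite_insert:
  "\<gamma> \<in> locally_finite_sets \<Longrightarrow> insert x \<gamma> \<in> locally_finite_sets"
  by (auto simp: locally_finite_sets_def Int_insert_left)

lemma locally_finite_translate:
  fixes a :: "'a::real_normed_vector"
  assumes "\<gamma> \<in> locally_finite_sets" shows "(+) a ` \<gamma> \<in> locally_finite_sets"
  unfolding locally_finite_sets_def
proof safe
  fix B :: "'a set" assume "bounded B"
  then have "bounded ((+) (-a) ` B)" by (rule bounded_translation)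
  then have "finite ((+) a ` (\<gamma> \<inter> (+) (-a) ` B))"
    using assms finite_locally_finite_Int by blast
  moreover have "(+) a ` \<gamma> \<inter> B \<subseteq> (+) a ` (\<gamma> \<inter> (+) (-a) ` B)"
    by force
  ultimately show "finite ((+) a ` \<gamma> \<inter> B)" by (rule finite_subset[rotated])
qed

lemma num_points_translate:
  fixes a :: "'a::real_normed_vector"
  shows "num_points B ((+) a ` \<gamma>) = num_points ((+) a -` B) \<gamma>"
proof -
  have "(+) a ` \<gamma> \<inter> B = (+) a ` (\<gamma> \<inter> (+) a -` B)" by auto
  then have "num_points B ((+) a ` \<gamma>) = emeasure (count_space UNIV) ((+) a ` (\<gamma> \<inter> (+) a -` B))"
    by (simp add: num_points_def)
  also have "\<dots> = num_points ((+) a -` B) \<gamma>"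
    by (simp add: num_points_def emeasure_count_space card_image finite_image_iff)
  finally show ?thesis .
qed

lemma measurable_translate_config:
  "(\<lambda>\<gamma>. (+) a ` \<gamma>) \<in> measurable config_space (config_space :: 'a::euclidean_space set measure)"
proof (rule measurable_config_spaceI)
  fix B :: "'a set" assume "B \<in> sets borel"
  then have "(+) a -` B \<in> sets borel"
    using measurable_sets[of "(+) a" borel borel B] by simp
  then show "(\<lambda>\<gamma>. num_points B ((+) a ` \<gamma>)) \<in> borel_measurable config_space"
    by (simp add: num_points_translate)
qed (simp add: locally_finite_translate)

lemma measurable_restrict_config [measurable]:
  assumes [measurable]: "B \<in> sets borel"
  shows "(\<lambda>\<gamma>. \<gamma> \<inter> B) \<in> measurable config_space (config_space :: 'a::euclidean_space set measure)"
proof (rule measurable_config_spaceI)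
  fix C :: "'a set" assume [measurable]: "C \<in> sets borel"
  have "num_points C (\<gamma> \<inter> B) = num_points (B \<inter> C) \<gamma>" for \<gamma>
    by (simp add: num_points_def Int_assoc)
  then show "(\<lambda>\<gamma>. num_points C (\<gamma> \<inter> B)) \<in> borel_measurable config_space" by simp
qed (auto intro: locally_finite_subset)

section \<open>Measurability of sums, nearest neighbours and energies\<close>

lemma nn_integral_count_space_restrict:
  "(\<integral>\<^sup>+y. f y * indicator B y \<partial>count_space A) = (\<integral>\<^sup>+y. f y \<partial>count_space (A \<inter> B))"
  by (subst (1 2) nn_integral_count_space_indicator)
     (auto intro!: nn_integral_cong simp: indicator_def)

text \<open>
  A locally finite configuration acts as a \<open>\<sigma>\<close>-finite kernel. Its restriction to a ball is a finite
  measure; dividing by one plus its mass turns it into a subprobability, for which measurability of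
  parametrised integrals is known, and monotone convergence over growing balls recovers the sum.
\<close>

lemma measurable_sum_over_config:
  fixes g :: "'b \<Rightarrow> 'a::euclidean_space set"
  assumes g [measurable]: "g \<in> measurable M config_space"
    and f [measurable]: "(\<lambda>(\<omega>, y). f \<omega> y) \<in> borel_measurable (M \<Otimes>\<^sub>M borel)"
  shows "(\<lambda>\<omega>. \<integral>\<^sup>+y. f \<omega> y \<partial>count_space (g \<omega>)) \<in> borel_measurable M"
proof -
  define B :: "nat \<Rightarrow> 'a set" where "B n = ball 0 (real n)" for n
  have B [measurable]: "B n \<in> sets borel" for n by (simp add: B_def)
  define c where "c n \<omega> = 1 + num_points (B n) (g \<omega>)" for n \<omega>
  define L where "L n \<omega> = scale_measure (inverse (c n \<omega>)) (distr (count_space (g \<omega> \<inter> B n)) borel (\<lambda>y. y))" for n \<omega>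
  have [measurable]: "c n \<in> borel_measurable M" for n
    unfolding c_def by measurable
  have lf: "g \<omega> \<in> locally_finite_sets" if "\<omega> \<in> space M" for \<omega>
    using measurable_space[OF g that] by simp
  have fin: "finite (g \<omega> \<inter> B n)" if "\<omega> \<in> space M" for \<omega> n
    using finite_locally_finite_Int[OF lf[OF that]] by (simp add: B_def)
  have c: "c n \<omega> \<noteq> 0" "c n \<omega> \<noteq> \<top>" if "\<omega> \<in> space M" for n \<omega>
    using fin[OF that, of n] by (auto simp: c_def num_points_eq_card)
  have c_inv: "inverse (c n \<omega>) * c n \<omega> = 1" if "\<omega> \<in> space M" for n \<omega>
    using ennreal_divide_self[OF c(1)[OF that, of n]] c(2)[OF that, of n]
    by (simp add: divide_ennreal_def mult.commute less_top)
  have em: "emeasure (L n \<omega>) A = inverse (c n \<omega>) * num_points (B n \<inter> A) (g \<omega>)"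
    if "\<omega> \<in> space M" "A \<in> sets borel" for n \<omega> A
  proof -
    have "emeasure (distr (count_space (g \<omega> \<inter> B n)) borel (\<lambda>y. y)) A
      = emeasure (count_space (g \<omega> \<inter> B n)) (A \<inter> (g \<omega> \<inter> B n))"
      using that by (subst emeasure_distr) auto
    also have "\<dots> = num_points (B n \<inter> A) (g \<omega>)"
      using fin[OF that(1), of n]
      by (subst emeasure_count_space) (auto simp: num_points_eq_card Int_ac)
    finally show ?thesis by (simp add: L_def)
  qed
  have Lmeas: "L n \<in> measurable M (subprob_algebra borel)" for n
  proof (rule measurable_subprob_algebra)
    fix \<omega> assume w: "\<omega> \<in> space M"
    show "sets (L n \<omega>) = sets borel" by (simp add: L_def)
    have sp: "space (L n \<omega>) = UNIV" by (simp add: L_def space_scale_measure)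
    have "emeasure (L n \<omega>) (space (L n \<omega>)) = inverse (c n \<omega>) * num_points (B n) (g \<omega>)"
      using em[OF w, of UNIV n] by (simp add: sp)
    also have "\<dots> \<le> inverse (c n \<omega>) * c n \<omega>"
      by (intro mult_left_mono) (auto simp: c_def)
    also have "\<dots> = 1" by (rule c_inv[OF w])
    finally show "subprob_space (L n \<omega>)"
      by (intro subprob_spaceI) (auto simp: sp)
  next
    fix A :: "'a set" assume A [measurable]: "A \<in> sets borel"
    have "(\<lambda>\<omega>. inverse (c n \<omega>) * num_points (B n \<inter> A) (g \<omega>)) \<in> borel_measurable M"
      by measurable
    then show "(\<lambda>\<omega>. emeasure (L n \<omega>) A) \<in> borel_measurable M"
      by (rule measurable_cong[THEN iffD1, rotated]) (simp add: em A)
  qed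
  have part: "(\<lambda>\<omega>. \<integral>\<^sup>+y. f \<omega> y \<partial>count_space (g \<omega> \<inter> B n)) \<in> borel_measurable M" for n
  proof -
    have "(\<lambda>\<omega>. c n \<omega> * (\<integral>\<^sup>+y. f \<omega> y \<partial>L n \<omega>)) \<in> borel_measurable M"
      using nn_integral_measurable_subprob_algebra2[OF f Lmeas] by measurable
    moreover have "c n \<omega> * (\<integral>\<^sup>+y. f \<omega> y \<partial>L n \<omega>) = (\<integral>\<^sup>+y. f \<omega> y \<partial>count_space (g \<omega> \<inter> B n))"
      if w: "\<omega> \<in> space M" for \<omega>
    proof -
      have fm: "f \<omega> \<in> borel_measurable borel"
        using measurable_compose[OF measurable_Pair1'[OF w] f] by simp
      have "c n \<omega> * (\<integral>\<^sup>+y. f \<omega> y \<partial>L n \<omega>)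
        = (c n \<omega> * inverse (c n \<omega>)) * (\<integral>\<^sup>+y. f \<omega> y \<partial>count_space (g \<omega> \<inter> B n))"
        unfolding L_def using fm
        by (simp add: nn_integral_scale_measure nn_integral_distr mult.assoc)
      also have "c n \<omega> * inverse (c n \<omega>) = 1"
        using c_inv[OF w] by (simp add: mult.commute)
      finally show ?thesis by simp
    qed
    ultimately show ?thesis by (rule measurable_cong[THEN iffD1, rotated]) simp
  qed
  have "(\<integral>\<^sup>+y. f \<omega> y \<partial>count_space (g \<omega>)) = (SUP n. \<integral>\<^sup>+y. f \<omega> y \<partial>count_space (g \<omega> \<inter> B n))" for \<omega>
  proof -
    have "(SUP n. f \<omega> y * indicator (B n) y) = f \<omega> y" for y
    proof (rule antisym)
      show "(SUP n. f \<omega> y * indicator (B n) y) \<le> f \<omega> y"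
        by (rule SUP_least) (auto simp: indicator_def)
      obtain n where "norm y < real n" using reals_Archimedean2 by blast
      then have "f \<omega> y = f \<omega> y * indicator (B n) y" by (simp add: B_def)
      then show "f \<omega> y \<le> (SUP n. f \<omega> y * indicator (B n) y)"
        by (metis SUP_upper UNIV_I)
    qed
    then have "(\<integral>\<^sup>+y. f \<omega> y \<partial>count_space (g \<omega>)) = (\<integral>\<^sup>+y. (SUP n. f \<omega> y * indicator (B n) y) \<partial>count_space (g \<omega>))"
      by simp
    also have "\<dots> = (SUP n. \<integral>\<^sup>+y. f \<omega> y * indicator (B n) y \<partial>count_space (g \<omega>))"
      by (rule nn_integral_monotone_convergence_SUP)
         (auto simp: incseq_def le_fun_def B_def indicator_def)
    finally show ?thesis by (simp add: nn_integral_count_space_restrict)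
  qed
  then show ?thesis using part by simp
qed

text \<open>
  For real terms the unordered sum exists exactly when it converges absolutely, and its default
  value is \<open>0\<close> otherwise. So it is a measurable expression in the sums of the positive and of the
  negative parts, whether or not the terms are summable.
\<close>

lemma borel_measurable_infsum_config:
  fixes g :: "'b \<Rightarrow> 'a::euclidean_space set" and F :: "'b \<Rightarrow> 'a \<Rightarrow> real"
  assumes g [measurable]: "g \<in> measurable M config_space"
    and F [measurable]: "(\<lambda>(\<omega>, y). F \<omega> y) \<in> borel_measurable (M \<Otimes>\<^sub>M borel)"
  shows "(\<lambda>\<omega>. \<Sum>\<^sub>\<infinity>y\<in>g \<omega>. F \<omega> y) \<in> borel_measurable M"
proof -
  define P where "P \<omega> = (\<integral>\<^sup>+y. ennreal (F \<omega> y) \<partial>count_space (g \<omega>))" for \<omega>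
  define N where "N \<omega> = (\<integral>\<^sup>+y. ennreal (- F \<omega> y) \<partial>count_space (g \<omega>))" for \<omega>
  have [measurable]: "P \<in> borel_measurable M" "N \<in> borel_measurable M"
    unfolding P_def N_def by (intro measurable_sum_over_config g; measurable)+
  have "(\<Sum>\<^sub>\<infinity>y\<in>g \<omega>. F \<omega> y) = (if P \<omega> < \<top> \<and> N \<omega> < \<top> then enn2real (P \<omega>) - enn2real (N \<omega>) else 0)" for \<omega>
  proof (cases "integrable (count_space (g \<omega>)) (F \<omega>)")
    case True
    then have "(\<Sum>\<^sub>\<infinity>y\<in>g \<omega>. F \<omega> y) = (\<integral>y. F \<omega> y \<partial>count_space (g \<omega>))"
      by (subst infsetsum_infsum[symmetric]) (simp_all add: infsetsum_def Infinite_Set_Sum.abs_summable_on_def)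
    then show ?thesis
      using True by (simp add: real_lebesgue_integral_def P_def N_def real_integrable_def less_top)
  next
    case False
    then have "\<not> (\<lambda>y. norm (F \<omega> y)) summable_on g \<omega>"
      using abs_summable_equivalent[of "F \<omega>" "g \<omega>", unfolded Infinite_Set_Sum.abs_summable_on_def] by blast
    then have "(\<Sum>\<^sub>\<infinity>y\<in>g \<omega>. F \<omega> y) = 0"
      using summable_on_iff_abs_summable_on_real[of "F \<omega>" "g \<omega>"] infsum_not_exists by blast
    then show ?thesis
      using False by (auto simp: P_def N_def real_integrable_def less_top)
  qed
  then show ?thesis by simp
qed

lemma closer_irrefl: "\<not> closer x y y"
  by (simp add: closer_def less_fun_irrefl)

lemma closer_trans: "closer x u v \<Longrightarrow> closer x v w \<Longrightarrow> closer x u w"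
  by (auto simp: closer_def intro: less_fun_trans)

lemma closer_total:
  fixes x u v :: "real ^ 'n::{finite,linorder}"
  shows "closer x u v \<or> u = v \<or> closer x v u"
proof -
  have "less_fun (vec_nth u) (vec_nth v) \<or> vec_nth u = vec_nth v \<or> less_fun (vec_nth v) (vec_nth u)"
    by (rule less_fun_trichotomy) simp
  then show ?thesis by (auto simp: closer_def vec_nth_inject)
qed

lemma closer_imp_dist_le: "closer x u v \<Longrightarrow> dist x u \<le> dist x v"
  by (auto simp: closer_def)

definition nearer_points ::
    "real ^ 'n::{finite,linorder} \<Rightarrow> (real ^ 'n::{finite,linorder}) set \<Rightarrow> real ^ 'n::{finite,linorder} \<Rightarrow> (real ^ 'n::{finite,linorder}) set" where
  "nearer_points x \<gamma> y = {w \<in> \<gamma> - {x}. closer x w y}"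

lemma is_neighbour_iff:
  "is_neighbour i x \<gamma> y \<longleftrightarrow> y \<in> \<gamma> \<and> y \<noteq> x \<and> card (nearer_points x \<gamma> y) + 1 = i"
  by (simp add: is_neighbour_def nearer_points_def)

lemma finite_nearer_points:
  assumes "\<gamma> \<in> locally_finite_sets" shows "finite (nearer_points x \<gamma> y)"
proof (rule finite_subset)
  show "nearer_points x \<gamma> y \<subseteq> \<gamma> \<inter> cball x (dist x y)"
    by (auto simp: nearer_points_def dest: closer_imp_dist_le)
  show "finite (\<gamma> \<inter> cball x (dist x y))"
    using assms by (rule finite_locally_finite_Int) simp
qed

lemma is_neighbour_unique:
  assumes "\<gamma> \<in> locally_finite_sets" "is_neighbour i x \<gamma> y" "is_neighbour i x \<gamma> y'"
  shows "y = y'"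
proof -
  have False if "closer x u v" "is_neighbour i x \<gamma> u" "is_neighbour i x \<gamma> v" for u v
  proof -
    have "nearer_points x \<gamma> u \<subset> nearer_points x \<gamma> v"
      using that closer_irrefl[of x u]
      by (auto simp: nearer_points_def is_neighbour_iff intro: closer_trans)
    then have "card (nearer_points x \<gamma> u) < card (nearer_points x \<gamma> v)"
      by (intro psubset_card_mono finite_nearer_points assms)
    then show False using that by (simp add: is_neighbour_iff)
  qed
  then show ?thesis using closer_total[of x y y'] assms by blast
qed

lemma neighbour_eq_Some_iff:
  assumes "\<gamma> \<in> locally_finite_sets"
  shows "neighbour i x \<gamma> = Some y \<longleftrightarrow> is_neighbour i x \<gamma> y"
  unfolding neighbour_def using is_neighbour_unique[OF assms]
  by (auto intro: theI2 the_equality)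

lemma mem_neighbours_iff:
  assumes "\<gamma> \<in> locally_finite_sets"
  shows "y \<in> neighbours k x \<gamma> \<longleftrightarrow> y \<in> \<gamma> \<and> y \<noteq> x \<and> card (nearer_points x \<gamma> y) < k"
  by (auto simp: neighbours_def neighbour_eq_Some_iff[OF assms] is_neighbour_iff)

lemma finite_neighbours: "finite (neighbours k x \<gamma>)"
proof -
  have "neighbours k x \<gamma> \<subseteq> (\<lambda>i. the (neighbour i x \<gamma>)) ` {1..k}"
    by (force simp: neighbours_def)
  then show ?thesis by (rule finite_subset) simp
qed

lemma borel_measurable_vec_component [measurable]:
  "(\<lambda>v :: real ^ 'n. v $ i) \<in> borel_measurable borel"
  by (intro borel_measurable_continuous_onI continuous_intros)

lemma pred_less_fun [measurable]:
  "Measurable.pred (borel \<Otimes>\<^sub>M borel)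
     (\<lambda>(u :: real ^ 'n::{finite,linorder}, v :: real ^ 'n::{finite,linorder}). less_fun (vec_nth u) (vec_nth v))"
proof -
  have "(\<lambda>p. \<exists>i. fst p $ i < snd p $ i \<and> (\<forall>j. j < i \<longrightarrow> fst p $ j = snd p $ j))
      \<in> measurable (borel \<Otimes>\<^sub>M (borel :: (real ^ 'n::{finite,linorder}) measure)) (count_space UNIV)"
    by measurable
  then show ?thesis by (simp add: less_fun_def case_prod_beta')
qed

lemma pred_closer [measurable (raw)]:
  fixes x u v :: "'b \<Rightarrow> real ^ 'n::{finite,linorder}"
  assumes [measurable]: "x \<in> borel_measurable M" "u \<in> borel_measurable M" "v \<in> borel_measurable M"
  shows "Measurable.pred M (\<lambda>\<omega>. closer (x \<omega>) (u \<omega>) (v \<omega>))"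
proof -
  have [measurable]: "Measurable.pred M (\<lambda>\<omega>. less_fun (vec_nth (u \<omega>)) (vec_nth (v \<omega>)))"
    using measurable_compose[OF _ pred_less_fun, of "\<lambda>\<omega>. (u \<omega>, v \<omega>)" M] by simp
  show ?thesis unfolding closer_def by measurable
qed

text \<open>
  Membership of a measurable point is the value of a sum over the configuration, namely of the
  indicator of that point.
\<close>

lemma pred_mem_config:
  fixes y :: "'b \<Rightarrow> 'a::euclidean_space"
  assumes [measurable]: "g \<in> measurable M config_space" "y \<in> borel_measurable M"
  shows "Measurable.pred M (\<lambda>\<omega>. y \<omega> \<in> g \<omega>)"
proof -
  have "(\<lambda>\<omega>. \<integral>\<^sup>+w. (if w = y \<omega> then 1 else 0 :: ennreal) \<partial>count_space (g \<omega>)) \<in> borel_measurable M"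
    by (rule measurable_sum_over_config) measurable
  moreover have "(\<integral>\<^sup>+w. (if w = y \<omega> then 1 else 0 :: ennreal) \<partial>count_space (g \<omega>)) = indicator (g \<omega>) (y \<omega>)" for \<omega>
  proof -
    have "(\<integral>\<^sup>+w. (if w = y \<omega> then 1 else 0 :: ennreal) \<partial>count_space (g \<omega>))
        = (\<integral>\<^sup>+w. indicator {y \<omega>} w \<partial>count_space (g \<omega>))"
      by (intro nn_integral_cong) (simp add: indicator_def)
    also have "\<dots> = (\<integral>\<^sup>+w. 1 * indicator {y \<omega>} w \<partial>count_space (g \<omega>))" by simp
    also have "\<dots> = indicator (g \<omega>) (y \<omega>)"
      unfolding nn_integral_count_space_restrict by (cases "y \<omega> \<in> g \<omega>") (auto simp: indicator_def)
    finally show ?thesis .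
  qed
  ultimately have "(\<lambda>\<omega>. indicator (g \<omega>) (y \<omega>) :: ennreal) \<in> borel_measurable M" by simp
  then have "Measurable.pred M (\<lambda>\<omega>. (indicator (g \<omega>) (y \<omega>) :: ennreal) = 1)" by measurable
  then show ?thesis by (simp add: indicator_def)
qed

lemma measurable_insert_config [measurable (raw)]:
  fixes x :: "'b \<Rightarrow> 'a::euclidean_space"
  assumes [measurable]: "g \<in> measurable M config_space" "x \<in> borel_measurable M"
  shows "(\<lambda>\<omega>. insert (x \<omega>) (g \<omega>)) \<in> measurable M config_space"
proof (rule measurable_config_spaceI)
  fix \<omega> assume "\<omega> \<in> space M"
  then show "insert (x \<omega>) (g \<omega>) \<in> locally_finite_sets"
    using measurable_space[OF assms(1)] by (simp add: locally_finite_insert)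
next
  fix B :: "'a set" assume [measurable]: "B \<in> sets borel"
  have [measurable]: "Measurable.pred M (\<lambda>\<omega>. x \<omega> \<in> g \<omega>)" by (rule pred_mem_config) fact+
  have "num_points B (insert (x \<omega>) (g \<omega>)) = num_points B (g \<omega>) + (if x \<omega> \<in> B \<and> x \<omega> \<notin> g \<omega> then 1 else 0)" for \<omega>
    by (cases "finite (g \<omega> \<inter> B)")
       (auto simp: num_points_def emeasure_count_space Int_insert_left card_insert_if)
  then show "(\<lambda>\<omega>. num_points B (insert (x \<omega>) (g \<omega>))) \<in> borel_measurable M" by simp
qed

lemma measurable_card_nearer_points [measurable (raw)]:
  fixes x y :: "'b \<Rightarrow> real ^ 'n::{finite,linorder}"
  assumes g [measurable]: "g \<in> measurable M config_space"
    and [measurable]: "x \<in> borel_measurable M" "y \<in> borel_measurable M"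
  shows "(\<lambda>\<omega>. card (nearer_points (x \<omega>) (g \<omega>) (y \<omega>))) \<in> measurable M (count_space UNIV)"
proof -
  define c where "c \<omega> = (\<integral>\<^sup>+w. (if w \<noteq> x \<omega> \<and> closer (x \<omega>) w (y \<omega>) then 1 else 0 :: ennreal) \<partial>count_space (g \<omega>))" for \<omega>
  have [measurable]: "c \<in> borel_measurable M"
    unfolding c_def by (rule measurable_sum_over_config) measurable
  have c: "c \<omega> = of_nat (card (nearer_points (x \<omega>) (g \<omega>) (y \<omega>)))" if "\<omega> \<in> space M" for \<omega>
  proof -
    let ?S = "nearer_points (x \<omega>) (g \<omega>) (y \<omega>)"
    have "c \<omega> = (\<integral>\<^sup>+w. 1 * indicator ?S w \<partial>count_space (g \<omega>))"
      unfolding c_def by (intro nn_integral_cong) (simp add: nearer_points_def indicator_def)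
    also have "\<dots> = (\<integral>\<^sup>+w. 1 \<partial>count_space (g \<omega> \<inter> ?S))"
      by (rule nn_integral_count_space_restrict)
    also have "g \<omega> \<inter> ?S = ?S" by (auto simp: nearer_points_def)
    also have "(\<integral>\<^sup>+w. 1 \<partial>count_space ?S) = of_nat (card ?S)"
      using finite_nearer_points measurable_space[OF g that] by (simp add: emeasure_count_space)
    finally show ?thesis .
  qed
  have "(\<lambda>\<omega>. card (nearer_points (x \<omega>) (g \<omega>) (y \<omega>))) -` {i} \<inter> space M \<in> sets M" for i
  proof -
    have "{\<omega> \<in> space M. c \<omega> = of_nat i} \<in> sets M" by measurable
    also have "{\<omega> \<in> space M. c \<omega> = of_nat i}
        = (\<lambda>\<omega>. card (nearer_points (x \<omega>) (g \<omega>) (y \<omega>))) -` {i} \<inter> space M"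
      by (auto simp: c)
    finally show ?thesis .
  qed
  then show ?thesis by (simp add: measurable_count_space_eq2_countable)
qed

lemma pred_is_neighbour [measurable (raw)]:
  fixes x y :: "'b \<Rightarrow> real ^ 'n::{finite,linorder}"
  assumes [measurable]: "g \<in> measurable M config_space"
    "x \<in> borel_measurable M" "y \<in> borel_measurable M"
  shows "Measurable.pred M (\<lambda>\<omega>. is_neighbour i (x \<omega>) (g \<omega>) (y \<omega>))"
proof -
  have [measurable]: "Measurable.pred M (\<lambda>\<omega>. y \<omega> \<in> g \<omega>)" by (rule pred_mem_config) fact+
  show ?thesis unfolding is_neighbour_iff by measurable
qed

lemma pred_mem_neighbours [measurable (raw)]:
  fixes x y :: "'b \<Rightarrow> real ^ 'n::{finite,linorder}"
  assumes g [measurable]: "g \<in> measurable M config_space"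
    and [measurable]: "x \<in> borel_measurable M" "y \<in> borel_measurable M"
  shows "Measurable.pred M (\<lambda>\<omega>. y \<omega> \<in> neighbours k (x \<omega>) (g \<omega>))"
proof -
  have [measurable]: "Measurable.pred M (\<lambda>\<omega>. y \<omega> \<in> g \<omega>)" by (rule pred_mem_config) fact+
  have "Measurable.pred M (\<lambda>\<omega>. y \<omega> \<in> g \<omega> \<and> y \<omega> \<noteq> x \<omega> \<and> card (nearer_points (x \<omega>) (g \<omega>) (y \<omega>)) < k)"
    by measurable
  then show ?thesis
    by (rule measurable_cong[THEN iffD1, rotated])
       (use measurable_space[OF g] in \<open>simp add: mem_neighbours_iff\<close>)
qed

text \<open>
  Neighbours are chosen by counting how many points are closer, so every ingredient of the energy
  can be written as a sum over the configuration. The term with the \<open>k\<close>-th neighbour becomes a sum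
  with at most one nonzero term, which also takes the value \<open>0\<close> if there is no such neighbour.
\<close>

lemma measurable_local_energy [measurable (raw)]:
  fixes x :: "'b \<Rightarrow> real ^ 'n::{finite,linorder}"
  assumes g [measurable]: "g \<in> measurable M config_space"
    and [measurable]: "x \<in> borel_measurable M" "\<Phi> \<in> borel_measurable borel"
  shows "(\<lambda>\<omega>. local_energy k \<Phi> (x \<omega>) (g \<omega>)) \<in> borel_measurable M"
proof -
  define K where "K y \<gamma> = (\<Sum>\<^sub>\<infinity>w\<in>\<gamma>. of_bool (is_neighbour k y \<gamma> w) * \<Phi> (y - w))" for y \<gamma>
  define E where "E \<omega> = (\<Sum>\<^sub>\<infinity>y\<in>g \<omega>. of_bool (y \<in> neighbours k (x \<omega>) (g \<omega>)) * \<Phi> (x \<omega> - y))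
      + (\<Sum>\<^sub>\<infinity>y\<in>g \<omega>. of_bool (x \<omega> \<in> neighbours k y (insert (x \<omega>) (g \<omega>))) * (\<Phi> (y - x \<omega>) - K y (g \<omega>)))" for \<omega>
  have [measurable]: "(\<lambda>p. K (snd p) (g (fst p))) \<in> borel_measurable (M \<Otimes>\<^sub>M borel)"
    unfolding K_def by (rule borel_measurable_infsum_config) measurable
  have "E \<in> borel_measurable M"
    unfolding E_def
    by (intro borel_measurable_add borel_measurable_infsum_config g) measurable
  moreover have "E \<omega> = local_energy k \<Phi> (x \<omega>) (g \<omega>)" if "\<omega> \<in> space M" for \<omega>
  proof -
    have lf: "g \<omega> \<in> locally_finite_sets" using measurable_space[OF g that] by simp
    let ?N = "neighbours k (x \<omega>) (g \<omega>)"
    have sub: "?N \<subseteq> g \<omega>" by (auto simp: mem_neighbours_iff[OF lf])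
    have "(\<Sum>\<^sub>\<infinity>y\<in>g \<omega>. of_bool (y \<in> ?N) * \<Phi> (x \<omega> - y)) = (\<Sum>\<^sub>\<infinity>y\<in>?N. \<Phi> (x \<omega> - y))"
      by (rule infsum_cong_neutral) (use sub in auto)
    also have "\<dots> = (\<Sum>y\<in>?N. \<Phi> (x \<omega> - y))"
      by (rule infsum_finite) (rule finite_neighbours)
    finally have 1: "(\<Sum>\<^sub>\<infinity>y\<in>g \<omega>. of_bool (y \<in> ?N) * \<Phi> (x \<omega> - y)) = (\<Sum>y\<in>?N. \<Phi> (x \<omega> - y))" .
    have 2: "K y (g \<omega>) = (case neighbour k y (g \<omega>) of None \<Rightarrow> 0 | Some w \<Rightarrow> \<Phi> (y - w))" for y
    proof (cases "neighbour k y (g \<omega>)")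
      case None
      then have "\<not> is_neighbour k y (g \<omega>) w" for w
        by (simp add: neighbour_eq_Some_iff[OF lf, symmetric])
      then show ?thesis by (simp add: None K_def)
    next
      case (Some w)
      then have w: "is_neighbour k y (g \<omega>) u \<longleftrightarrow> u = w" for u
        by (auto simp: neighbour_eq_Some_iff[OF lf, symmetric])
      have "w \<in> g \<omega>" using w by (auto simp: is_neighbour_iff)
      then have "K y (g \<omega>) = (\<Sum>\<^sub>\<infinity>u\<in>{w}. \<Phi> (y - u))"
        unfolding K_def by (intro infsum_cong_neutral) (auto simp: w)
      then show ?thesis by (simp add: Some)
    qed
    show ?thesis unfolding E_def local_energy_def 1 2 ..
  qed
  ultimately show ?thesis by (rule measurable_cong[THEN iffD1, rotated]) simp
qed

section \<open>Screening by nearby points\<close>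

lemma le_card_nearer_points:
  assumes "\<gamma> \<in> locally_finite_sets" "S \<subseteq> nearer_points y \<gamma> w" "k \<le> card S"
  shows "k \<le> card (nearer_points y \<gamma> w)"
  using card_mono[OF finite_nearer_points[OF assms(1)] assms(2)] assms(3) by linarith

text \<open>
  In the ranking seen from \<open>y\<close>, all points of \<open>S\<close> come before \<open>x\<close>.
\<close>

lemma not_mem_neighbours_if_shielded:
  assumes "\<gamma> \<in> locally_finite_sets" "S \<subseteq> \<gamma> - {y}" "k \<le> card S"
    and "\<And>s. s \<in> S \<Longrightarrow> dist y s < dist y x"
  shows "x \<notin> neighbours k y (insert x \<gamma>)"
proof -
  have "S \<subseteq> nearer_points y (insert x \<gamma>) x"
    using assms by (auto simp: nearer_points_def closer_def)
  then have "k \<le> card (nearer_points y (insert x \<gamma>) x)"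
    using assms by (intro le_card_nearer_points locally_finite_insert)
  then show ?thesis
    by (simp add: mem_neighbours_iff locally_finite_insert assms)
qed

text \<open>
  If \<open>B\<close> contains \<open>k\<close> points that are closer to \<open>y\<close> than everything outside \<open>B\<close>, then a point that has
  a competitor outside \<open>B\<close> at least as good as itself is beaten by all of these, so its rank exceeds
  \<open>k\<close> whether or not the configuration is restricted to \<open>B\<close>. For all other points the restriction does
  not change the rank.
\<close>

lemma is_neighbour_restrict:
  assumes "\<gamma> \<in> locally_finite_sets" "S \<subseteq> \<gamma> \<inter> B - {y}" "k \<le> card S"
    and far: "\<And>s w. s \<in> S \<Longrightarrow> w \<notin> B \<Longrightarrow> dist y s < dist y w" and "i \<le> k"
  shows "is_neighbour i y \<gamma> w \<longleftrightarrow> is_neighbour i y (\<gamma> \<inter> B) w"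
proof (cases "\<exists>u. u \<notin> B \<and> (u = w \<or> closer y u w)")
  case True
  then obtain u where u: "u \<notin> B" "u = w \<or> closer y u w" by blast
  have "closer y s w" if "s \<in> S" for s
  proof -
    have "closer y s u" using far[OF that u(1)] by (simp add: closer_def)
    then show ?thesis using u(2) closer_trans by blast
  qed
  then have "S \<subseteq> nearer_points y \<gamma> w" "S \<subseteq> nearer_points y (\<gamma> \<inter> B) w"
    using assms(2) by (auto simp: nearer_points_def)
  then have "k \<le> card (nearer_points y \<gamma> w)" "k \<le> card (nearer_points y (\<gamma> \<inter> B) w)"
    using assms(1,3) by (auto intro!: le_card_nearer_points locally_finite_subset[of \<gamma>])
  then show ?thesis using \<open>i \<le> k\<close> by (auto simp: is_neighbour_iff)
next
  case False
  then have "nearer_points y (\<gamma> \<inter> B) w = nearer_points y \<gamma> w" "w \<in> B"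
    by (auto simp: nearer_points_def)
  then show ?thesis by (simp add: is_neighbour_iff)
qed

lemma neighbour_restrict:
  assumes "\<gamma> \<in> locally_finite_sets" "S \<subseteq> \<gamma> \<inter> B - {y}" "k \<le> card S"
    and "\<And>s w. s \<in> S \<Longrightarrow> w \<notin> B \<Longrightarrow> dist y s < dist y w"
  shows "i \<le> k \<Longrightarrow> neighbour i y \<gamma> = neighbour i y (\<gamma> \<inter> B)"
    and "neighbours k y \<gamma> = neighbours k y (\<gamma> \<inter> B)"
proof -
  show *: "neighbour i y \<gamma> = neighbour i y (\<gamma> \<inter> B)" if "i \<le> k" for i
  proof -
    have "is_neighbour i y \<gamma> = is_neighbour i y (\<gamma> \<inter> B)"
      using is_neighbour_restrict[OF assms that] by (rule ext)
    then show ?thesis by (simp add: neighbour_def)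
  qed
  show "neighbours k y \<gamma> = neighbours k y (\<gamma> \<inter> B)"
    by (auto simp: neighbours_def *)
qed

text \<open>
  The set \<open>T\<close> is meant to be a finite \<open>1\<close>-net of the sphere of radius \<open>5\<close>. Each ball around a point of the net
  must hold \<open>k + 1\<close> points, one more than needed to fill \<open>k\<close> places, because the point whose neighbours
  are sought may itself lie in the ball. The bound \<open>K\<close> keeps the energy bounded. Points in the core
  \<open>ball v 1\<close> are not mentioned, so that the event does not change when such points are added or
  removed.
\<close>

definition screened :: "'a::euclidean_space set \<Rightarrow> nat \<Rightarrow> nat \<Rightarrow> 'a \<Rightarrow> 'a set \<Rightarrow> bool" where
  "screened T k K v \<gamma> \<longleftrightarrow> num_points (ball v 16 - ball v 1) \<gamma> \<le> of_nat K \<and>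
     (\<forall>p\<in>T. of_nat (Suc k) \<le> num_points (ball (v + p) 1) \<gamma>)"

lemma le_card_Diff_singleton:
  "finite A \<Longrightarrow> Suc k \<le> card A \<Longrightarrow> k \<le> card (A - {y})"
  by (cases "y \<in> A") (auto simp: card_Diff_singleton)

text \<open>
  A point \<open>y\<close> at distance at least \<open>5\<close> from \<open>v\<close> sees a crowded ball in front of the core, whose points
  are closer to \<open>y\<close> than \<open>x\<close> is. A point \<open>y\<close> at distance less than \<open>5\<close> has \<open>k\<close> points of a crowded ball
  within distance \<open>11\<close>, whereas everything outside \<open>ball v 16\<close> is farther than that. In both cases
  the term of \<open>y\<close> in the energy is not affected by the points outside \<open>ball v 16\<close>. The second case includes \<open>y = x\<close>, which settles the sum over
  the neighbours of \<open>x\<close>.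
\<close>

lemma local_energy_screened:
  fixes x v :: "real ^ 'n::{finite,linorder}"
  assumes lf: "\<gamma> \<in> locally_finite_sets" and scr: "screened T k K v \<gamma>"
    and T: "T \<subseteq> sphere 0 5" "sphere 0 5 \<subseteq> (\<Union>p\<in>T. ball p 1)"
    and x: "x \<in> ball v 1"
  shows "local_energy k \<Phi> x \<gamma> = local_energy k \<Phi> x (\<gamma> \<inter> ball v 16)"
proof -
  define B where "B = ball v 16"
  have xB: "x \<in> B" using x by (simp add: B_def)
  have lfB: "\<gamma> \<inter> B \<in> locally_finite_sets" using lf by (rule locally_finite_subset) simp
  define S where "S p y = \<gamma> \<inter> ball (v + p) 1 - {y}" for p y
  have norm_T: "norm p = 5" if "p \<in> T" for p using T that by auto
  have cardS: "k \<le> card (S p y)" if "p \<in> T" for p y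
  proof -
    have fin: "finite (\<gamma> \<inter> ball (v + p) 1)" using lf by (rule finite_locally_finite_Int) simp
    then have "Suc k \<le> card (\<gamma> \<inter> ball (v + p) 1)"
      using scr that unfolding screened_def by (metis of_nat_le_num_points_iff)
    then show ?thesis unfolding S_def by (rule le_card_Diff_singleton[OF fin])
  qed
  have SB: "S p y \<subseteq> \<gamma> \<inter> B - {y}" and Sv: "\<And>s. s \<in> S p y \<Longrightarrow> dist v s < 6" if "p \<in> T" for p y
  proof -
    show *: "dist v s < 6" if "s \<in> S p y" for s
      using that norm_T[OF \<open>p \<in> T\<close>] dist_triangle[of v s "v + p"]
      by (auto simp: S_def dist_norm)
    show "S p y \<subseteq> \<gamma> \<inter> B - {y}"
      using * by (fastforce simp: S_def B_def)
  qed
  have away: "x \<notin> neighbours k y (insert x \<gamma>)" "x \<notin> neighbours k y (insert x (\<gamma> \<inter> B))"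
    if y: "5 \<le> dist v y" for y
  proof -
    \<comment> \<open>the point where the segment from \<open>v\<close> to \<open>y\<close> meets the sphere, relative to \<open>v\<close>\<close>
    define q where "q = (5 / norm (y - v)) *\<^sub>R (y - v)"
    have ny: "norm (y - v) \<ge> 5" using y by (simp add: dist_norm norm_minus_commute)
    then have yv: "y \<noteq> v" by force
    have ratio: "5 / norm (y - v) \<le> 1" using ny by (simp add: divide_le_eq)
    from yv have "q \<in> sphere 0 5" by (simp add: q_def)
    then obtain p where p: "p \<in> T" "dist p q < 1" using T by auto
    have "y - (v + q) = (1 - 5 / norm (y - v)) *\<^sub>R (y - v)"
      by (simp add: q_def algebra_simps)
    then have "dist y (v + q) = (1 - 5 / norm (y - v)) * norm (y - v)"
      using ratio by (simp add: dist_norm)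
    also have "\<dots> = dist v y - 5"
      using yv by (simp add: left_diff_distrib dist_norm norm_minus_commute)
    finally have q: "dist y (v + q) = dist v y - 5" .
    have "dist y s < dist y x" if "s \<in> S p y" for s
    proof -
      have "dist (v + p) s < 1" using that by (simp add: S_def)
      moreover have "dist (v + q) (v + p) < 1" using p by (simp add: dist_commute)
      moreover have "dist y s \<le> dist y (v + q) + dist (v + q) (v + p) + dist (v + p) s"
        using dist_triangle[of y s "v + q"] dist_triangle[of "v + q" s "v + p"] by linarith
      moreover have "dist v y \<le> dist v x + dist y x"
        using dist_triangle[of v y x] by (simp add: dist_commute)
      ultimately show ?thesis using q x by simp
    qed
    note shield = this SB[OF p(1), of y]
    show "x \<notin> neighbours k y (insert x \<gamma>)"
      by (rule not_mem_neighbours_if_shielded[OF lf _ cardS[OF p(1)]]) (use shield in blast)+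
    show "x \<notin> neighbours k y (insert x (\<gamma> \<inter> B))"
      by (rule not_mem_neighbours_if_shielded[OF lfB _ cardS[OF p(1)]]) (use shield in blast)+
  qed
  obtain p where p: "p \<in> T"
  proof -
    obtain e :: "real ^ 'n::{finite,linorder}" where "norm e = 5" using vector_choose_size[of 5] by auto
    then have "e \<in> sphere 0 5" by simp
    then have "e \<in> (\<Union>p\<in>T. ball p 1)" using T(2) by blast
    then show ?thesis using that by auto
  qed
  have far: "dist y s < dist y w" if "dist v y < 5" "s \<in> S p y" "w \<notin> B" for y s w
    using Sv[OF p that(2)] that(1,3) dist_triangle[of y s v] dist_triangle[of v w y]
    by (simp add: B_def dist_commute)
  have near: "neighbour k y \<gamma> = neighbour k y (\<gamma> \<inter> B)"
      "neighbours k y \<gamma> = neighbours k y (\<gamma> \<inter> B)"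
      "neighbours k y (insert x \<gamma>) = neighbours k y (insert x (\<gamma> \<inter> B))"
    if y: "dist v y < 5" for y
  proof -
    show "neighbour k y \<gamma> = neighbour k y (\<gamma> \<inter> B)" "neighbours k y \<gamma> = neighbours k y (\<gamma> \<inter> B)"
      using far[OF y] by (auto intro!: neighbour_restrict[OF lf SB[OF p, of y] cardS[OF p]])
    have "neighbours k y (insert x \<gamma>) = neighbours k y (insert x \<gamma> \<inter> B)"
      using far[OF y] SB[OF p, of y] cardS[OF p]
      by (intro neighbour_restrict(2)[where S = "S p y"] locally_finite_insert lf) auto
    then show "neighbours k y (insert x \<gamma>) = neighbours k y (insert x (\<gamma> \<inter> B))"
      using xB by simp
  qed
  have "(\<Sum>\<^sub>\<infinity>y\<in>\<gamma>. of_bool (x \<in> neighbours k y (insert x \<gamma>)) *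
        (\<Phi> (y - x) - (case neighbour k y \<gamma> of None \<Rightarrow> 0 | Some w \<Rightarrow> \<Phi> (y - w))))
     = (\<Sum>\<^sub>\<infinity>y\<in>\<gamma> \<inter> B. of_bool (x \<in> neighbours k y (insert x (\<gamma> \<inter> B))) *
        (\<Phi> (y - x) - (case neighbour k y (\<gamma> \<inter> B) of None \<Rightarrow> 0 | Some w \<Rightarrow> \<Phi> (y - w))))"
  proof (rule infsum_cong_neutral)
    fix y assume "y \<in> \<gamma> - \<gamma> \<inter> B"
    then have "5 \<le> dist v y" by (auto simp: B_def)
    then show "of_bool (x \<in> neighbours k y (insert x \<gamma>)) *
        (\<Phi> (y - x) - (case neighbour k y \<gamma> of None \<Rightarrow> 0 | Some w \<Rightarrow> \<Phi> (y - w))) = 0"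
      using away by simp
  next
    fix y
    show "of_bool (x \<in> neighbours k y (insert x \<gamma>)) *
        (\<Phi> (y - x) - (case neighbour k y \<gamma> of None \<Rightarrow> 0 | Some w \<Rightarrow> \<Phi> (y - w)))
      = of_bool (x \<in> neighbours k y (insert x (\<gamma> \<inter> B))) *
        (\<Phi> (y - x) - (case neighbour k y (\<gamma> \<inter> B) of None \<Rightarrow> 0 | Some w \<Rightarrow> \<Phi> (y - w)))"
      using away[of y] near[of y] by (cases "5 \<le> dist v y") simp_all
  qed auto
  moreover have "neighbours k x \<gamma> = neighbours k x (\<gamma> \<inter> B)"
    using x by (intro near) simp
  ultimately show ?thesis by (simp add: local_energy_def B_def)
qed

text \<open>
  In a finite configuration both sums have at most one term per point, bounded by \<open>M\<close> and \<open>2 * M\<close>.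
\<close>

lemma abs_local_energy_le:
  assumes fin: "finite \<gamma>" and M: "\<And>u. \<bar>\<Phi> u\<bar> \<le> M"
  shows "\<bar>local_energy k \<Phi> x \<gamma>\<bar> \<le> 3 * M * card \<gamma>"
proof -
  have lf: "\<gamma> \<in> locally_finite_sets" using fin by (simp add: locally_finite_sets_def)
  have M0: "0 \<le> M" using M[of 0] by linarith
  define t where "t y = of_bool (x \<in> neighbours k y (insert x \<gamma>)) *
        (\<Phi> (y - x) - (case neighbour k y \<gamma> of None \<Rightarrow> 0 | Some w \<Rightarrow> \<Phi> (y - w)))" for y
  have sub: "neighbours k x \<gamma> \<subseteq> \<gamma>" by (auto simp: mem_neighbours_iff[OF lf])
  have "\<bar>\<Sum>y\<in>neighbours k x \<gamma>. \<Phi> (x - y)\<bar> \<le> (\<Sum>y\<in>neighbours k x \<gamma>. M)"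
    by (rule order_trans[OF sum_abs sum_mono]) (rule M)
  also have "\<dots> \<le> M * card \<gamma>"
    using card_mono[OF fin sub] M0 by (simp add: mult.commute mult_left_mono)
  finally have 1: "\<bar>\<Sum>y\<in>neighbours k x \<gamma>. \<Phi> (x - y)\<bar> \<le> M * card \<gamma>" .
  have t: "\<bar>t y\<bar> \<le> 2 * M" for y
  proof -
    have "\<bar>case neighbour k y \<gamma> of None \<Rightarrow> 0 | Some w \<Rightarrow> \<Phi> (y - w)\<bar> \<le> M"
      using M M0 by (simp split: option.split)
    then show ?thesis using M[of "y - x"] M0 unfolding t_def by (auto simp: of_bool_def)
  qed
  have "\<bar>\<Sum>y\<in>\<gamma>. t y\<bar> \<le> (\<Sum>y\<in>\<gamma>. 2 * M)"
    by (rule order_trans[OF sum_abs sum_mono]) (rule t)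
  then have 2: "\<bar>\<Sum>y\<in>\<gamma>. t y\<bar> \<le> 2 * M * card \<gamma>" by (simp add: mult_ac)
  have "local_energy k \<Phi> x \<gamma> = (\<Sum>y\<in>neighbours k x \<gamma>. \<Phi> (x - y)) + (\<Sum>y\<in>\<gamma>. t y)"
    unfolding local_energy_def t_def using fin by simp
  then show ?thesis using 1 2 by linarith
qed

section \<open>Adding and removing points with the Georgii--Nguyen--Zessin equation\<close>

locale gibbs_with_intensity =
  fixes \<Gamma> :: "'a::euclidean_space set measure" and lam :: "'a \<Rightarrow> 'a set \<Rightarrow> ennreal"
  assumes gibbs: "gibbs_process \<Gamma> lam"
    and intensity_measurable: "(\<lambda>(x, \<gamma>). lam x \<gamma>) \<in> borel_measurable (borel \<Otimes>\<^sub>M config_space)"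
    and intensity_pos: "\<And>x \<gamma>. 0 < lam x \<gamma>"

sublocale gibbs_with_intensity \<subseteq> prob_space \<Gamma>
  using gibbs by (simp add: gibbs_process_def point_process_def)

context gibbs_with_intensity
begin

lemma sets_process [measurable_cong, simp]: "sets \<Gamma> = sets config_space"
  using gibbs by (simp add: gibbs_process_def point_process_def)

lemma space_process [simp]: "space \<Gamma> = locally_finite_sets"
  using sets_eq_imp_space_eq[OF sets_process] by simp

lemma intensity_measurable' [measurable (raw)]:
  assumes [measurable]: "f \<in> borel_measurable M" "g \<in> measurable M config_space"
  shows "(\<lambda>\<omega>. lam (f \<omega>) (g \<omega>)) \<in> borel_measurable M"
  using measurable_compose[OF _ intensity_measurable, of "\<lambda>\<omega>. (f \<omega>, g \<omega>)" M] by simp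

lemma gnz:
  "f \<in> borel_measurable (borel \<Otimes>\<^sub>M config_space) \<Longrightarrow>
   (\<integral>\<^sup>+\<gamma>. (\<integral>\<^sup>+x. f (x, \<gamma> - {x}) \<partial>count_space \<gamma>) \<partial>\<Gamma>) =
   (\<integral>\<^sup>+\<gamma>. (\<integral>\<^sup>+x. f (x, \<gamma>) * lam x \<gamma> \<partial>lborel) \<partial>\<Gamma>)"
  using gibbs by (simp add: gibbs_process_def)

text \<open>
  The equation is applied to the function that asks \<open>x\<close> to lie in \<open>Q\<close> and the rest of the configuration to
  avoid \<open>Q\<close>. The sum over the points then has a nonzero term only if \<open>Q\<close> contains exactly one point, and
  removing that point does not change \<open>G\<close>.
\<close>

lemma one_point_vs_empty:
  assumes [measurable]: "Q \<in> sets borel" "G \<in> borel_measurable config_space"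
    and G: "\<And>\<gamma>. G (\<gamma> - Q) = G \<gamma>"
  shows "(\<integral>\<^sup>+\<gamma>. (if num_points Q \<gamma> = 1 then G \<gamma> else 0) \<partial>\<Gamma>) =
    (\<integral>\<^sup>+\<gamma>. (if num_points Q \<gamma> = 0 then G \<gamma> * (\<integral>\<^sup>+x\<in>Q. lam x \<gamma> \<partial>lborel) else 0) \<partial>\<Gamma>)"
proof -
  define f where "f = (\<lambda>(x, \<gamma>). (if num_points Q \<gamma> = 0 then G \<gamma> else 0) * indicator Q x)"
  have f: "f \<in> borel_measurable (borel \<Otimes>\<^sub>M config_space)"
    unfolding f_def by measurable
  have lhs: "(\<integral>\<^sup>+x. f (x, \<gamma> - {x}) \<partial>count_space \<gamma>) = (if num_points Q \<gamma> = 1 then G \<gamma> else 0)" for \<gamma>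
  proof (cases "num_points Q \<gamma> = 1")
    case True
    then obtain x where x: "\<gamma> \<inter> Q = {x}" by (auto simp: num_points_eq_1_iff)
    have "f (y, \<gamma> - {y}) = G \<gamma> * indicator Q y" if "y \<in> \<gamma>" for y
    proof (cases "y \<in> Q")
      case y: True
      then have "y = x" using that x by auto
      then have "\<gamma> - {y} - Q = \<gamma> - Q" "(\<gamma> - {y}) \<inter> Q = {}" using x by auto
      then have "num_points Q (\<gamma> - {y}) = 0" "G (\<gamma> - {y}) = G \<gamma>"
        using G[of "\<gamma> - {y}"] G[of \<gamma>] by (simp_all add: num_points_eq_0_iff)
      then show ?thesis by (simp add: f_def)
    qed (simp add: f_def)
    then have "(\<integral>\<^sup>+y. f (y, \<gamma> - {y}) \<partial>count_space \<gamma>) = (\<integral>\<^sup>+y. G \<gamma> * indicator Q y \<partial>count_space \<gamma>)"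
      by (intro nn_integral_cong) simp
    also have "\<dots> = G \<gamma>"
      unfolding nn_integral_count_space_restrict x by (simp add: nn_integral_count_space_finite)
    finally show ?thesis using True by simp
  next
    case False
    have "f (y, \<gamma> - {y}) = 0" if "y \<in> \<gamma>" for y
    proof (rule ccontr)
      assume "f (y, \<gamma> - {y}) \<noteq> 0"
      then have "y \<in> Q" "(\<gamma> - {y}) \<inter> Q = {}"
        by (auto simp: f_def num_points_eq_0_iff indicator_def split: if_splits)
      then have "\<gamma> \<inter> Q = {y}" using that by auto
      then show False using False by (auto simp: num_points_eq_1_iff)
    qed
    then have "(\<integral>\<^sup>+y. f (y, \<gamma> - {y}) \<partial>count_space \<gamma>) = (\<integral>\<^sup>+y. 0 \<partial>count_space \<gamma>)"
      by (intro nn_integral_cong) simp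
    then show ?thesis using False by simp
  qed
  have rhs: "(\<integral>\<^sup>+x. f (x, \<gamma>) * lam x \<gamma> \<partial>lborel) =
      (if num_points Q \<gamma> = 0 then G \<gamma> * (\<integral>\<^sup>+x\<in>Q. lam x \<gamma> \<partial>lborel) else 0)"
    if "\<gamma> \<in> locally_finite_sets" for \<gamma>
  proof (cases "num_points Q \<gamma> = 0")
    case True
    have [measurable]: "(\<lambda>x. lam x \<gamma>) \<in> borel_measurable borel"
      by (rule intensity_measurable'[OF measurable_ident_sets[OF refl] measurable_const]) (simp add: that)
    have "(\<integral>\<^sup>+x. f (x, \<gamma>) * lam x \<gamma> \<partial>lborel) = (\<integral>\<^sup>+x. G \<gamma> * (lam x \<gamma> * indicator Q x) \<partial>lborel)"
      by (simp add: f_def True mult_ac)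
    also have "\<dots> = G \<gamma> * (\<integral>\<^sup>+x\<in>Q. lam x \<gamma> \<partial>lborel)"
      by (rule nn_integral_cmult) measurable
    finally show ?thesis by (simp add: True)
  qed (simp add: f_def)
  show ?thesis
    using gnz[OF f] unfolding lhs
    by (simp add: rhs cong: nn_integral_cong_simp)
qed

text \<open>
  If \<open>E\<close> had positive probability, the right-hand side of the equation for the indicator of \<open>U\<close> times
  that of \<open>E\<close> would be positive, as the intensity is; but the left-hand side only counts
  configurations in \<open>E'\<close>.
\<close>

lemma possible_add_point:
  assumes [measurable]: "Measurable.pred config_space E" "Measurable.pred config_space E'" "U \<in> sets borel"
    and U: "emeasure lborel U \<noteq> 0"
    and step: "\<And>\<gamma> x. \<gamma> \<in> locally_finite_sets \<Longrightarrow> E \<gamma> \<Longrightarrow> x \<in> U \<Longrightarrow> x \<notin> \<gamma> \<Longrightarrow> E' (insert x \<gamma>)"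
    and never: "AE \<gamma> in \<Gamma>. \<not> E' \<gamma>"
  shows "AE \<gamma> in \<Gamma>. \<not> E \<gamma>"
proof -
  define f :: "'a \<times> 'a set \<Rightarrow> ennreal" where "f = (\<lambda>(x, \<gamma>). (if E \<gamma> then 1 else 0) * indicator U x)"
  have f: "f \<in> borel_measurable (borel \<Otimes>\<^sub>M config_space)"
    unfolding f_def by measurable
  have "AE \<gamma> in \<Gamma>. (\<integral>\<^sup>+x. f (x, \<gamma> - {x}) \<partial>count_space \<gamma>) = 0"
    using never AE_space
  proof eventually_elim
    case (elim \<gamma>)
    have "f (x, \<gamma> - {x}) = 0" if "x \<in> \<gamma>" for x
      using step[of "\<gamma> - {x}" x] elim that locally_finite_subset[of \<gamma> "\<gamma> - {x}"]
      by (auto simp: f_def insert_absorb indicator_def)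
    then have "(\<integral>\<^sup>+x. f (x, \<gamma> - {x}) \<partial>count_space \<gamma>) = (\<integral>\<^sup>+x. 0 \<partial>count_space \<gamma>)"
      by (intro nn_integral_cong) simp
    then show ?case by simp
  qed
  then have "(\<integral>\<^sup>+\<gamma>. (\<integral>\<^sup>+x. f (x, \<gamma> - {x}) \<partial>count_space \<gamma>) \<partial>\<Gamma>) = (\<integral>\<^sup>+\<gamma>. 0 \<partial>\<Gamma>)"
    by (rule nn_integral_cong_AE)
  then have "(\<integral>\<^sup>+\<gamma>. (\<integral>\<^sup>+x. f (x, \<gamma>) * lam x \<gamma> \<partial>lborel) \<partial>\<Gamma>) = 0"
    using gnz[OF f] by simp
  moreover have "(\<lambda>\<gamma>. \<integral>\<^sup>+x. f (x, \<gamma>) * lam x \<gamma> \<partial>lborel) \<in> borel_measurable \<Gamma>"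
    unfolding f_def by measurable
  ultimately have "AE \<gamma> in \<Gamma>. (\<integral>\<^sup>+x. f (x, \<gamma>) * lam x \<gamma> \<partial>lborel) = 0"
    by (simp add: nn_integral_0_iff_AE)
  then show ?thesis using AE_space
  proof eventually_elim
    case (elim \<gamma>)
    then have "\<gamma> \<in> space config_space" by simp
    then have [measurable]: "(\<lambda>x. lam x \<gamma>) \<in> borel_measurable borel"
      by (rule intensity_measurable'[OF measurable_ident_sets[OF refl] measurable_const])
    show "\<not> E \<gamma>"
    proof
      assume "E \<gamma>"
      then have "(\<integral>\<^sup>+x. indicator U x * lam x \<gamma> \<partial>lborel) = 0"
        using elim(1) by (simp add: f_def)
      then have "AE x in lborel. indicator U x * lam x \<gamma> = 0"
        by (subst (asm) nn_integral_0_iff_AE) measurable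
      then have "AE x in lborel. x \<notin> U"
      proof eventually_elim
        case (elim x)
        then show ?case using intensity_pos[of x \<gamma>] by (auto simp: indicator_def)
      qed
      then have "emeasure lborel U = 0"
        by (simp add: AE_iff_measurable[OF _ refl])
      then show False using U by simp
    qed
  qed
qed

text \<open>
  Here the right-hand side vanishes, and the left-hand side dominates the probability of \<open>E\<close>. This
  comparison uses only the monotonicity of the integral, as the inner sum on the left is not known
  to be measurable.
\<close>

lemma possible_remove_point:
  assumes [measurable]: "Measurable.pred config_space E" "Measurable.pred config_space E'" "U \<in> sets borel"
    and step: "\<And>\<gamma>. \<gamma> \<in> locally_finite_sets \<Longrightarrow> E \<gamma> \<Longrightarrow> \<exists>x\<in>\<gamma> \<inter> U. E' (\<gamma> - {x})"
    and never: "AE \<gamma> in \<Gamma>. \<not> E' \<gamma>"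
  shows "AE \<gamma> in \<Gamma>. \<not> E \<gamma>"
proof -
  define f :: "'a \<times> 'a set \<Rightarrow> ennreal" where "f = (\<lambda>(x, \<gamma>). (if E' \<gamma> then 1 else 0) * indicator U x)"
  have f: "f \<in> borel_measurable (borel \<Otimes>\<^sub>M config_space)"
    unfolding f_def by measurable
  have "AE \<gamma> in \<Gamma>. (\<integral>\<^sup>+x. f (x, \<gamma>) * lam x \<gamma> \<partial>lborel) = 0"
    using never by eventually_elim (simp add: f_def)
  then have "(\<integral>\<^sup>+\<gamma>. (\<integral>\<^sup>+x. f (x, \<gamma>) * lam x \<gamma> \<partial>lborel) \<partial>\<Gamma>) = (\<integral>\<^sup>+\<gamma>. 0 \<partial>\<Gamma>)"
    by (rule nn_integral_cong_AE)
  then have z: "(\<integral>\<^sup>+\<gamma>. (\<integral>\<^sup>+x. f (x, \<gamma> - {x}) \<partial>count_space \<gamma>) \<partial>\<Gamma>) = 0"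
    using gnz[OF f] by simp
  have "(\<integral>\<^sup>+\<gamma>. (if E \<gamma> then 1 else 0) \<partial>\<Gamma>) \<le> (\<integral>\<^sup>+\<gamma>. (\<integral>\<^sup>+x. f (x, \<gamma> - {x}) \<partial>count_space \<gamma>) \<partial>\<Gamma>)"
  proof (rule nn_integral_mono)
    fix \<gamma> assume "\<gamma> \<in> space \<Gamma>"
    show "(if E \<gamma> then 1 else 0) \<le> (\<integral>\<^sup>+x. f (x, \<gamma> - {x}) \<partial>count_space \<gamma>)"
    proof (cases "E \<gamma>")
      case True
      then obtain x where x: "x \<in> \<gamma>" "x \<in> U" "E' (\<gamma> - {x})"
        using step \<open>\<gamma> \<in> space \<Gamma>\<close> by auto
      then have "1 = f (x, \<gamma> - {x})" by (simp add: f_def)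
      also have "\<dots> \<le> (\<integral>\<^sup>+x. f (x, \<gamma> - {x}) \<partial>count_space \<gamma>)"
        using x(1) by (rule nn_integral_ge_point)
      finally show ?thesis by simp
    qed simp
  qed
  then have "(\<integral>\<^sup>+\<gamma>. (if E \<gamma> then 1 else 0) \<partial>\<Gamma>) = (0 :: ennreal)" using z by simp
  then have "AE \<gamma> in \<Gamma>. (if E \<gamma> then 1 else 0) = (0 :: ennreal)"
    by (subst (asm) nn_integral_0_iff_AE) measurable
  then show ?thesis by eventually_elim (auto split: if_splits)
qed

text \<open>
  Some number of points in \<open>B\<close> has positive probability, and points can be removed one at a time.
\<close>

lemma possibly_empty:
  assumes B: "B \<in> sets borel" "bounded B"
  shows "\<not> (AE \<gamma> in \<Gamma>. num_points B \<gamma> \<noteq> 0)"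
proof
  note [measurable] = B(1)
  assume empty: "AE \<gamma> in \<Gamma>. num_points B \<gamma> \<noteq> 0"
  have "AE \<gamma> in \<Gamma>. num_points B \<gamma> \<noteq> of_nat j" for j
  proof (induction j)
    case 0 then show ?case using empty by simp
  next
    case (Suc j)
    show ?case
    proof (rule possible_remove_point[of "\<lambda>\<gamma>. num_points B \<gamma> = of_nat (Suc j)" "\<lambda>\<gamma>. num_points B \<gamma> = of_nat j" B])
      fix \<gamma> :: "'a set" assume g: "\<gamma> \<in> locally_finite_sets" and N: "num_points B \<gamma> = of_nat (Suc j)"
      have fin: "finite (\<gamma> \<inter> B)" using g B(2) by (rule finite_locally_finite_Int)
      have c: "card (\<gamma> \<inter> B) = Suc j"
        using N unfolding num_points_eq_card[OF fin] by (metis of_nat_eq_iff)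
      then have "\<gamma> \<inter> B \<noteq> {}" by auto
      then obtain x where x: "x \<in> \<gamma> \<inter> B" by blast
      have "(\<gamma> - {x}) \<inter> B = \<gamma> \<inter> B - {x}" by auto
      then have "num_points B (\<gamma> - {x}) = of_nat j"
        using fin c x by (subst num_points_eq_card) (auto simp: card_Diff_singleton)
      then show "\<exists>x\<in>\<gamma> \<inter> B. num_points B (\<gamma> - {x}) = of_nat j" using x by blast
    qed (use Suc in \<open>measurable\<close>)
  qed
  then have "AE \<gamma> in \<Gamma>. \<forall>j. num_points B \<gamma> \<noteq> of_nat j" by (simp add: AE_all_countable)
  then have "AE \<gamma> in \<Gamma>. False" using AE_space
  proof eventually_elim
    case (elim \<gamma>)
    then show ?case using num_points_eq_card[OF finite_locally_finite_Int[OF _ B(2)], of \<gamma>] by auto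
  qed
  then show False by simp
qed

text \<open>
  Starting from an empty \<open>B\<close>, points are added one at a time, one for each element of the multiset \<open>M\<close>.
  The sets in \<open>M\<close> may overlap: an additional point never decreases the other counts.
\<close>

lemma possibly_crowded:
  assumes B: "B \<in> sets borel" "bounded B" "Q \<in> sets borel" "Q \<subseteq> B"
    and M: "\<And>U. U \<in># M \<Longrightarrow> U \<in> sets borel \<and> U \<inter> Q = {} \<and> emeasure lborel U \<noteq> 0"
  shows "\<exists>n::nat. \<not> (AE \<gamma> in \<Gamma>. \<not> (num_points B \<gamma> \<le> of_nat n \<and> num_points Q \<gamma> = 0 \<and>
      (\<forall>U\<in>#M. of_nat (count M U) \<le> num_points U \<gamma>)))"
  using M
proof (induction M)
  case empty
  have "\<not> (AE \<gamma> in \<Gamma>. \<not> (num_points B \<gamma> \<le> of_nat 0 \<and> num_points Q \<gamma> = 0))"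
  proof
    assume "AE \<gamma> in \<Gamma>. \<not> (num_points B \<gamma> \<le> of_nat 0 \<and> num_points Q \<gamma> = 0)"
    then have "AE \<gamma> in \<Gamma>. num_points B \<gamma> \<noteq> 0"
      by eventually_elim (use B(4) in \<open>auto simp: num_points_eq_0_iff\<close>)
    then show False using possibly_empty[OF B(1,2)] by simp
  qed
  then show ?case by (intro exI[of _ 0]) simp
next
  case (add V M)
  note [measurable] = B(1,3)
  have [measurable]: "U \<in> sets borel" if "U \<in># add_mset V M" for U using add.prems that by blast
  have V: "V \<in> sets borel" "V \<inter> Q = {}" "emeasure lborel V \<noteq> 0" using add.prems by auto
  obtain n :: nat where n: "\<not> (AE \<gamma> in \<Gamma>. \<not> (num_points B \<gamma> \<le> of_nat n \<and> num_points Q \<gamma> = 0 \<and>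
      (\<forall>U\<in>#M. of_nat (count M U) \<le> num_points U \<gamma>)))"
    using add by auto
  show ?case
  proof (intro exI[of _ "Suc n"] notI)
    assume never: "AE \<gamma> in \<Gamma>. \<not> (num_points B \<gamma> \<le> of_nat (Suc n) \<and> num_points Q \<gamma> = 0 \<and>
      (\<forall>U\<in>#add_mset V M. of_nat (count (add_mset V M) U) \<le> num_points U \<gamma>))"
    have m: "Measurable.pred config_space (\<lambda>\<gamma>. num_points B \<gamma> \<le> of_nat n \<and> num_points Q \<gamma> = 0 \<and>
        (\<forall>U\<in>#M. of_nat (count M U) \<le> num_points U \<gamma>))"
      by measurable
    have m': "Measurable.pred config_space (\<lambda>\<gamma>. num_points B \<gamma> \<le> of_nat (Suc n) \<and> num_points Q \<gamma> = 0 \<and>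
        (\<forall>U\<in>#add_mset V M. of_nat (count (add_mset V M) U) \<le> num_points U \<gamma>))"
      by measurable
    have "AE \<gamma> in \<Gamma>. \<not> (num_points B \<gamma> \<le> of_nat n \<and> num_points Q \<gamma> = 0 \<and>
      (\<forall>U\<in>#M. of_nat (count M U) \<le> num_points U \<gamma>))"
    proof (rule possible_add_point[OF m m' V(1,3) _ never])
      fix \<gamma> x
      assume "num_points B \<gamma> \<le> of_nat n \<and> num_points Q \<gamma> = 0 \<and> (\<forall>U\<in>#M. of_nat (count M U) \<le> num_points U \<gamma>)"
      then have h: "num_points B \<gamma> \<le> of_nat n" "num_points Q \<gamma> = 0"
        "\<And>U. of_nat (count M U) \<le> num_points U \<gamma>"
        by (auto simp: not_in_iff)
      assume x: "x \<in> V" "x \<notin> \<gamma>"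
      have "num_points B (insert x \<gamma>) \<le> of_nat n + 1"
        unfolding num_points_insert[OF x(2)] using h(1) by (intro add_mono) (auto simp: indicator_def)
      moreover have "num_points Q (insert x \<gamma>) = 0"
        unfolding num_points_insert[OF x(2)] using h(2) x V(2) by (auto simp: indicator_def)
      moreover have "of_nat (count (add_mset V M) U) \<le> num_points U (insert x \<gamma>)" for U
        unfolding num_points_insert[OF x(2)] using h(3)[of U] x(1)
        by (auto simp: add_mono add.commute indicator_def intro: add_mono order_trans)
      ultimately show "num_points B (insert x \<gamma>) \<le> of_nat (Suc n) \<and> num_points Q (insert x \<gamma>) = 0 \<and>
        (\<forall>U\<in>#add_mset V M. of_nat (count (add_mset V M) U) \<le> num_points U (insert x \<gamma>))"
        by (simp add: add.commute)
    qed
    then show False using n by simp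
  qed
qed

end

section \<open>Orthogonal statistics and cubes\<close>

text \<open>
  The Cauchy--Schwarz inequality for \<open>Y\<close> and the sum \<open>H\<close> of the orthogonal variables, in the form that
  \<open>Y - t * H\<close> has a nonnegative second moment.
\<close>

lemma (in prob_space) second_moment_ge_orthogonal:
  fixes Y :: "'a \<Rightarrow> real" and \<psi> :: "'i \<Rightarrow> 'a \<Rightarrow> real"
  assumes V: "finite V"
    and Y [measurable]: "Y \<in> borel_measurable M" and Y2: "integrable M (\<lambda>\<omega>. (Y \<omega>)\<^sup>2)"
    and \<psi> [measurable]: "\<And>v. v \<in> V \<Longrightarrow> \<psi> v \<in> borel_measurable M"
    and bound: "\<And>v \<omega>. v \<in> V \<Longrightarrow> \<bar>\<psi> v \<omega>\<bar> \<le> C" and "0 < C"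
    and orth: "\<And>v w. v \<in> V \<Longrightarrow> w \<in> V \<Longrightarrow> v \<noteq> w \<Longrightarrow> (\<integral>\<omega>. \<psi> v \<omega> * \<psi> w \<omega> \<partial>M) = 0"
    and cov: "\<And>v. v \<in> V \<Longrightarrow> (\<integral>\<omega>. Y \<omega> * \<psi> v \<omega> \<partial>M) = m"
  shows "card V * (m\<^sup>2 / C\<^sup>2) \<le> (\<integral>\<omega>. (Y \<omega>)\<^sup>2 \<partial>M)"
proof -
  define H where "H \<omega> = (\<Sum>v\<in>V. \<psi> v \<omega>)" for \<omega>
  have Y1: "integrable M Y" using square_integrable_imp_integrable[OF Y Y2] .
  have prod_bound: "\<bar>\<psi> v \<omega> * \<psi> w \<omega>\<bar> \<le> C * C" if "v \<in> V" "w \<in> V" for v w \<omega>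
    unfolding abs_mult using bound[OF that(1)] bound[OF that(2)] \<open>0 < C\<close> by (intro mult_mono) auto
  have int_prod: "integrable M (\<lambda>\<omega>. \<psi> v \<omega> * \<psi> w \<omega>)" if "v \<in> V" "w \<in> V" for v w
    by (rule integrable_const_bound[where B = "C * C"]) (use prod_bound that in auto)
  have int_cov: "integrable M (\<lambda>\<omega>. Y \<omega> * \<psi> v \<omega>)" if v: "v \<in> V" for v
  proof (rule Bochner_Integration.integrable_bound)
    show "integrable M (\<lambda>\<omega>. C * Y \<omega>)" using Y1 by simp
    show "AE \<omega> in M. norm (Y \<omega> * \<psi> v \<omega>) \<le> norm (C * Y \<omega>)"
      using mult_right_mono[OF bound[OF v] abs_ge_zero] \<open>0 < C\<close>
      by (auto simp: abs_mult mult.commute)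
  qed (use v in measurable)
  have YH: "(\<integral>\<omega>. Y \<omega> * H \<omega> \<partial>M) = card V * m"
    and int_YH: "integrable M (\<lambda>\<omega>. Y \<omega> * H \<omega>)"
    using int_cov by (simp_all add: H_def sum_distrib_left cov)
  have HH: "(\<lambda>\<omega>. (H \<omega>)\<^sup>2) = (\<lambda>\<omega>. \<Sum>v\<in>V. \<Sum>w\<in>V. \<psi> v \<omega> * \<psi> w \<omega>)"
    by (simp add: H_def power2_eq_square sum_product)
  have int_HH: "integrable M (\<lambda>\<omega>. (H \<omega>)\<^sup>2)"
    unfolding HH using int_prod by auto
  have "(\<integral>\<omega>. (H \<omega>)\<^sup>2 \<partial>M) = (\<Sum>v\<in>V. \<Sum>w\<in>V. \<integral>\<omega>. \<psi> v \<omega> * \<psi> w \<omega> \<partial>M)"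
    unfolding HH using int_prod by simp
  also have "\<dots> = (\<Sum>v\<in>V. \<integral>\<omega>. \<psi> v \<omega> * \<psi> v \<omega> \<partial>M)"
  proof (rule sum.cong[OF refl])
    fix v assume v: "v \<in> V"
    have "(\<Sum>w\<in>V. \<integral>\<omega>. \<psi> v \<omega> * \<psi> w \<omega> \<partial>M) = (\<Sum>w\<in>V. if w = v then \<integral>\<omega>. \<psi> v \<omega> * \<psi> w \<omega> \<partial>M else 0)"
      using v orth by (intro sum.cong) auto
    then show "(\<Sum>w\<in>V. \<integral>\<omega>. \<psi> v \<omega> * \<psi> w \<omega> \<partial>M) = (\<integral>\<omega>. \<psi> v \<omega> * \<psi> v \<omega> \<partial>M)"
      using v V by simp
  qed
  also have "\<dots> \<le> (\<Sum>v\<in>V. C\<^sup>2)"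
  proof (rule sum_mono)
    fix v assume v: "v \<in> V"
    have "(\<integral>\<omega>. \<psi> v \<omega> * \<psi> v \<omega> \<partial>M) \<le> (\<integral>\<omega>. C\<^sup>2 \<partial>M)"
      using int_prod[OF v v] prod_bound[OF v v]
      by (intro integral_mono) (auto simp: power2_eq_square abs_le_iff)
    then show "(\<integral>\<omega>. \<psi> v \<omega> * \<psi> v \<omega> \<partial>M) \<le> C\<^sup>2" by (simp add: prob_space)
  qed
  finally have H2: "(\<integral>\<omega>. (H \<omega>)\<^sup>2 \<partial>M) \<le> card V * C\<^sup>2" by simp
  \<comment> \<open>the minimiser of the quadratic polynomial in \<open>t\<close> that bounds the second moment of \<open>Y - t * H\<close>\<close>
  define t where "t = m / C\<^sup>2"
  have "0 \<le> (\<integral>\<omega>. (Y \<omega> - t * H \<omega>)\<^sup>2 \<partial>M)" by simp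
  also have "(\<lambda>\<omega>. (Y \<omega> - t * H \<omega>)\<^sup>2) = (\<lambda>\<omega>. (Y \<omega>)\<^sup>2 - 2 * t * (Y \<omega> * H \<omega>) + t\<^sup>2 * (H \<omega>)\<^sup>2)"
    by (simp add: power2_eq_square algebra_simps)
  also have "(\<integral>\<omega>. (Y \<omega>)\<^sup>2 - 2 * t * (Y \<omega> * H \<omega>) + t\<^sup>2 * (H \<omega>)\<^sup>2 \<partial>M)
      = (\<integral>\<omega>. (Y \<omega>)\<^sup>2 \<partial>M) - 2 * t * (card V * m) + t\<^sup>2 * (\<integral>\<omega>. (H \<omega>)\<^sup>2 \<partial>M)"
    using Y2 int_YH int_HH by (simp add: YH)
  also have "\<dots> \<le> (\<integral>\<omega>. (Y \<omega>)\<^sup>2 \<partial>M) - 2 * t * (card V * m) + t\<^sup>2 * (card V * C\<^sup>2)"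
    using H2 by (intro add_left_mono mult_left_mono) auto
  also have "\<dots> = (\<integral>\<omega>. (Y \<omega>)\<^sup>2 \<partial>M) - card V * (m\<^sup>2 / C\<^sup>2)"
    using \<open>0 < C\<close> by (simp add: t_def field_simps power2_eq_square)
  finally show ?thesis by simp
qed

definition cube :: "real \<Rightarrow> 'a::euclidean_space set" where
  "cube c = cbox (- c *\<^sub>R One) (c *\<^sub>R One)"

lemma mem_cube_iff: "x \<in> cube c \<longleftrightarrow> (\<forall>b\<in>Basis. \<bar>x \<bullet> b\<bar> \<le> c)"
  by (force simp: cube_def mem_box abs_le_iff)

lemma emeasure_cube:
  "0 \<le> c \<Longrightarrow> emeasure lborel (cube c :: 'a::euclidean_space set) = ennreal ((2 * c) ^ DIM('a))"
  unfolding cube_def by (subst emeasure_lborel_cbox) (auto simp: inner_simps cong: prod.cong)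

text \<open>
  The centres are the points whose coordinates are integer multiples of \<open>2 * R\<close> of absolute value at
  most \<open>2 * R * n\<close>. The cubes of side \<open>2 * R\<close> around them tile the large cube, and the balls are inscribed
  in these tiles.
\<close>

lemma cube_packing:
  fixes R :: real
  assumes "0 < R"
  obtains V :: "'a::euclidean_space set" where "finite V" "0 < card V"
    "emeasure lborel (cube ((2 * real n + 1) * R) :: 'a set) = ennreal (card V * (2 * R) ^ DIM('a))"
    "\<And>v. v \<in> V \<Longrightarrow> ball v R \<subseteq> cube ((2 * real n + 1) * R)"
    "\<And>v w. v \<in> V \<Longrightarrow> w \<in> V \<Longrightarrow> v \<noteq> w \<Longrightarrow> ball v R \<inter> ball w R = {}"
proof -
  define F where "F = (Basis :: 'a set) \<rightarrow>\<^sub>E {- int n..int n}"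
  define c :: "('a \<Rightarrow> int) \<Rightarrow> 'a" where "c m = (\<Sum>b\<in>Basis. (2 * R * of_int (m b)) *\<^sub>R b)" for m
  have c: "c m \<bullet> b = 2 * R * of_int (m b)" if "b \<in> Basis" for m b
    using that by (simp add: c_def)
  have inj: "inj_on c F"
  proof (rule inj_onI)
    fix m m' assume m: "m \<in> F" "m' \<in> F" "c m = c m'"
    show "m = m'"
    proof (rule PiE_ext[OF m(1,2)[unfolded F_def]])
      fix b :: 'a assume "b \<in> Basis"
      then show "m b = m' b" using c[of b m] c[of b m'] m(3) \<open>0 < R\<close> by simp
    qed
  qed
  have "finite F" by (simp add: F_def finite_PiE)
  have card: "card (c ` F) = (2 * n + 1) ^ DIM('a)"
  proof -
    have "nat (2 * int n + 1) = 2 * n + 1" by simp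
    then show ?thesis unfolding card_image[OF inj] by (simp add: F_def card_PiE)
  qed
  show ?thesis
  proof (rule that[of "c ` F"])
    show "finite (c ` F)" using \<open>finite F\<close> by simp
    show "0 < card (c ` F)" by (simp add: card)
    have "2 * ((2 * real n + 1) * R) = real (2 * n + 1) * (2 * R)" by (simp add: algebra_simps)
    then show "emeasure lborel (cube ((2 * real n + 1) * R) :: 'a set) = ennreal (card (c ` F) * (2 * R) ^ DIM('a))"
      using \<open>0 < R\<close> by (simp add: emeasure_cube card power_mult_distrib add.commute)
    fix v assume "v \<in> c ` F"
    then obtain m where v: "v = c m" "m \<in> F" by blast
    show "ball v R \<subseteq> cube ((2 * real n + 1) * R)"
    proof
      fix x assume x: "x \<in> ball v R"
      have "\<bar>x \<bullet> b\<bar> \<le> (2 * real n + 1) * R" if b: "b \<in> Basis" for b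
      proof -
        have "\<bar>x \<bullet> b - v \<bullet> b\<bar> < R"
          using Basis_le_norm[OF b, of "x - v"] x by (simp add: inner_diff_left dist_norm norm_minus_commute)
        moreover have "\<bar>of_int (m b)\<bar> \<le> real n"
          using v(2) b by (force simp: F_def PiE_iff)
        then have "\<bar>v \<bullet> b\<bar> \<le> 2 * R * real n"
          using \<open>0 < R\<close> by (simp add: v(1) c b abs_mult)
        ultimately show ?thesis by (simp add: algebra_simps)
      qed
      then show "x \<in> cube ((2 * real n + 1) * R)" by (simp add: mem_cube_iff)
    qed
    fix w assume "w \<in> c ` F" "v \<noteq> w"
    then obtain m' where w: "w = c m'" by blast
    then obtain b where b: "b \<in> Basis" "v \<bullet> b \<noteq> w \<bullet> b"
      using \<open>v \<noteq> w\<close> euclidean_eqI[of v w] by blast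
    then have "m b \<noteq> m' b" by (auto simp: v w c)
    then have "1 \<le> \<bar>of_int (m b) - of_int (m' b) :: real\<bar>"
      by (metis of_int_1_le_iff of_int_abs of_int_diff int_one_le_iff_zero_less zero_less_abs_iff right_minus_eq)
    then have "2 * R \<le> \<bar>v \<bullet> b - w \<bullet> b\<bar>"
      using \<open>0 < R\<close> b by (simp add: v w c abs_mult flip: right_diff_distrib)
    also have "\<dots> \<le> dist v w"
      using Basis_le_norm[OF b(1), of "v - w"] by (simp add: inner_diff_left dist_norm)
    finally show "ball v R \<inter> ball w R = {}"
      using disjoint_ballI by force
  qed
qed

section \<open>Variance of order volume from a screened intensity\<close>

text \<open>
  This isolates what the argument uses of the interaction: whenever the core \<open>ball v r\<close> is empty and
  screened, the intensity integrated over the core is bounded and determined by the points in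
  \<open>ball v R\<close>. The bound \<open>1 \<le> C\<close> is a normalisation that lets \<open>C\<close> bound both parts of the score below.
\<close>

locale local_intensity_model = gibbs_with_intensity \<Gamma> lam
  for \<Gamma> :: "'a::euclidean_space set measure" and lam +
  fixes r R C :: real and screen :: "'a \<Rightarrow> 'a set \<Rightarrow> bool" and W :: "'a \<Rightarrow> 'a set \<Rightarrow> ennreal"
  assumes radii: "0 < r" "r < R"
    and C_ge: "1 \<le> C"
    and screen_measurable [measurable]: "\<And>v. Measurable.pred config_space (screen v)"
    and screen_local: "\<And>v \<gamma> \<gamma>'. \<gamma> \<inter> (ball v R - ball v r) = \<gamma>' \<inter> (ball v R - ball v r) \<Longrightarrow> screen v \<gamma> \<longleftrightarrow> screen v \<gamma>'"
    and screen_translate: "\<And>v \<gamma>. screen v ((+) v ` \<gamma>) \<longleftrightarrow> screen 0 \<gamma>"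
    and W_measurable [measurable]: "\<And>v. W v \<in> borel_measurable config_space"
    and W_local: "\<And>v \<gamma> \<gamma>'. \<gamma> \<inter> ball v R = \<gamma>' \<inter> ball v R \<Longrightarrow> W v \<gamma> = W v \<gamma>'"
    and W_eq: "\<And>v \<gamma>. \<gamma> \<in> locally_finite_sets \<Longrightarrow> screen v \<gamma> \<Longrightarrow> num_points (ball v r) \<gamma> = 0 \<Longrightarrow>
        (\<integral>\<^sup>+x\<in>ball v r. lam x \<gamma> \<partial>lborel) = W v \<gamma> \<and> W v \<gamma> \<le> ennreal C"
    and stationary: "stationary \<Gamma>"
    and possible: "\<not> (AE \<gamma> in \<Gamma>. \<not> (num_points (ball 0 r) \<gamma> = 1 \<and> screen 0 \<gamma>))"
begin

definition single :: "'a \<Rightarrow> 'a set \<Rightarrow> real" where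
  "single v \<gamma> = of_bool (num_points (ball v r) \<gamma> = 1 \<and> screen v \<gamma>)"

text \<open>
  The minimum makes the function bounded everywhere. It takes effect only outside
  the space of locally finite configurations, since \<open>W\<close> is at most \<open>C\<close> where the first factor is nonzero.
\<close>

definition vacant :: "'a \<Rightarrow> 'a set \<Rightarrow> real" where
  "vacant v \<gamma> = of_bool (num_points (ball v r) \<gamma> = 0 \<and> screen v \<gamma>) * min C (enn2real (W v \<gamma>))"

definition score :: "'a \<Rightarrow> 'a set \<Rightarrow> real" where
  "score v \<gamma> = single v \<gamma> - vacant v \<gamma>"

lemma measurable_scores [measurable]:
  "single v \<in> borel_measurable config_space" "vacant v \<in> borel_measurable config_space"
  "score v \<in> borel_measurable config_space"
proof -
  show [measurable]: "single v \<in> borel_measurable config_space" "vacant v \<in> borel_measurable config_space"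
    unfolding single_def vacant_def by measurable
  show "score v \<in> borel_measurable config_space" unfolding score_def by measurable
qed

lemma score_bounds:
  "0 \<le> single v \<gamma>" "single v \<gamma> \<le> C" "0 \<le> vacant v \<gamma>" "vacant v \<gamma> \<le> C"
  using C_ge by (auto simp: single_def vacant_def)

lemma scores_local:
  assumes "\<gamma> \<inter> ball v R = \<gamma>' \<inter> ball v R"
  shows "single v \<gamma> = single v \<gamma>'" "vacant v \<gamma> = vacant v \<gamma>'"
proof -
  have "ball v r \<subseteq> ball v R" using radii by auto
  then have "num_points (ball v r) \<gamma> = num_points (ball v r) \<gamma>'"
    using assms by (intro num_points_cong) auto
  moreover have "screen v \<gamma> \<longleftrightarrow> screen v \<gamma>'" using assms by (intro screen_local) blast
  ultimately show "single v \<gamma> = single v \<gamma>'" "vacant v \<gamma> = vacant v \<gamma>'"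
    using W_local[OF assms] by (simp_all add: single_def vacant_def)
qed

lemma integrable_mult_bounded:
  assumes [measurable]: "f \<in> borel_measurable config_space" and f: "\<And>\<gamma>. 0 \<le> f \<gamma>" "\<And>\<gamma>. f \<gamma> \<le> C"
    and G: "integrable \<Gamma> G"
  shows "integrable \<Gamma> (\<lambda>\<gamma>. f \<gamma> * G \<gamma> :: real)"
proof (rule Bochner_Integration.integrable_bound)
  show "integrable \<Gamma> (\<lambda>\<gamma>. C * G \<gamma>)" using G by simp
  show "(\<lambda>\<gamma>. f \<gamma> * G \<gamma>) \<in> borel_measurable \<Gamma>" using G by measurable
  show "AE \<gamma> in \<Gamma>. norm (f \<gamma> * G \<gamma>) \<le> norm (C * G \<gamma>)"
    using f C_ge by (auto simp: abs_mult intro!: mult_right_mono)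
qed

text \<open>
  Given what lies outside the core, the events of one point and of no point in the core are related by
  the factor \<open>W v\<close>; this is \<open>one_point_vs_empty\<close> for the function \<open>G\<close> restricted to the screened
  configurations.
\<close>

lemma integral_score_mult_eq_0:
  assumes G: "integrable \<Gamma> G" "\<And>\<gamma>. 0 \<le> G \<gamma>" "\<And>\<gamma>. G (\<gamma> - ball v r) = G \<gamma>"
  shows "(\<integral>\<gamma>. score v \<gamma> * G \<gamma> \<partial>\<Gamma>) = 0"
proof -
  have [measurable]: "G \<in> borel_measurable config_space"
    using G(1) by (simp add: borel_measurable_integrable cong: measurable_cong_sets)
  have inv: "screen v (\<gamma> - ball v r) = screen v \<gamma>" for \<gamma> by (rule screen_local) auto
  have "(\<integral>\<^sup>+\<gamma>. ennreal (single v \<gamma> * G \<gamma>) \<partial>\<Gamma>) =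
      (\<integral>\<^sup>+\<gamma>. (if num_points (ball v r) \<gamma> = 1 then (if screen v \<gamma> then ennreal (G \<gamma>) else 0) else 0) \<partial>\<Gamma>)"
    by (intro nn_integral_cong) (simp add: single_def)
  also have "\<dots> = (\<integral>\<^sup>+\<gamma>. (if num_points (ball v r) \<gamma> = 0 then
      (if screen v \<gamma> then ennreal (G \<gamma>) else 0) * (\<integral>\<^sup>+x\<in>ball v r. lam x \<gamma> \<partial>lborel) else 0) \<partial>\<Gamma>)"
    by (rule one_point_vs_empty) (simp_all add: inv G(3))
  also have "\<dots> = (\<integral>\<^sup>+\<gamma>. ennreal (vacant v \<gamma> * G \<gamma>) \<partial>\<Gamma>)"
  proof (rule nn_integral_cong)
    fix \<gamma> assume "\<gamma> \<in> space \<Gamma>"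
    then have g: "\<gamma> \<in> locally_finite_sets" by simp
    show "(if num_points (ball v r) \<gamma> = 0 then
      (if screen v \<gamma> then ennreal (G \<gamma>) else 0) * (\<integral>\<^sup>+x\<in>ball v r. lam x \<gamma> \<partial>lborel) else 0)
      = ennreal (vacant v \<gamma> * G \<gamma>)"
    proof (cases "num_points (ball v r) \<gamma> = 0 \<and> screen v \<gamma>")
      case True
      then have W: "(\<integral>\<^sup>+x\<in>ball v r. lam x \<gamma> \<partial>lborel) = W v \<gamma>" "W v \<gamma> \<le> ennreal C"
        using W_eq[OF g] by auto
      have fin: "W v \<gamma> < \<top>" using le_less_trans[OF W(2) ennreal_less_top] .
      have "enn2real (W v \<gamma>) \<le> C"
        using enn2real_mono[OF W(2)] C_ge by simp
      then have vac: "vacant v \<gamma> = enn2real (W v \<gamma>)" using True by (simp add: vacant_def)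
      have "ennreal (G \<gamma>) * W v \<gamma> = ennreal (G \<gamma>) * ennreal (enn2real (W v \<gamma>))"
        using fin by simp
      also have "\<dots> = ennreal (vacant v \<gamma> * G \<gamma>)"
        unfolding vac using G(2) by (simp add: ennreal_mult mult.commute)
      finally show ?thesis using True W by simp
    qed (auto simp: vacant_def)
  qed
  finally have eq: "(\<integral>\<^sup>+\<gamma>. ennreal (single v \<gamma> * G \<gamma>) \<partial>\<Gamma>) = (\<integral>\<^sup>+\<gamma>. ennreal (vacant v \<gamma> * G \<gamma>) \<partial>\<Gamma>)" .
  have "(\<integral>\<gamma>. single v \<gamma> * G \<gamma> \<partial>\<Gamma>) = (\<integral>\<gamma>. vacant v \<gamma> * G \<gamma> \<partial>\<Gamma>)"
    using eq score_bounds G(2) by (simp add: integral_eq_nn_integral)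
  moreover have "integrable \<Gamma> (\<lambda>\<gamma>. single v \<gamma> * G \<gamma>)" "integrable \<Gamma> (\<lambda>\<gamma>. vacant v \<gamma> * G \<gamma>)"
    using score_bounds G(1) by (auto intro!: integrable_mult_bounded)
  ultimately show ?thesis by (simp add: score_def left_diff_distrib)
qed

lemma integral_score_eq_0: "(\<integral>\<gamma>. score v \<gamma> \<partial>\<Gamma>) = 0"
  using integral_score_mult_eq_0[of "\<lambda>_. 1" v] by simp

text \<open>
  Both parts of the score of \<open>w\<close> are nonnegative and ignore the points near \<open>v\<close>.
\<close>

lemma scores_orthogonal:
  assumes "ball v R \<inter> ball w R = {}"
  shows "(\<integral>\<gamma>. score v \<gamma> * score w \<gamma> \<partial>\<Gamma>) = 0"
proof -
  have "ball v r \<subseteq> ball v R" using radii by auto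
  then have *: "(\<gamma> - ball v r) \<inter> ball w R = \<gamma> \<inter> ball w R" for \<gamma> using assms by auto
  have int: "integrable \<Gamma> (single w)" "integrable \<Gamma> (vacant w)"
    using integrable_mult_bounded[of "single w" "\<lambda>_. 1"] integrable_mult_bounded[of "vacant w" "\<lambda>_. 1"]
      score_bounds by auto
  have i: "integrable \<Gamma> (\<lambda>\<gamma>. score v \<gamma> * f \<gamma>)" if "integrable \<Gamma> f" for f
    unfolding score_def left_diff_distrib
    using that score_bounds by (auto intro!: integrable_mult_bounded)
  have "(\<integral>\<gamma>. score v \<gamma> * single w \<gamma> \<partial>\<Gamma>) = 0" "(\<integral>\<gamma>. score v \<gamma> * vacant w \<gamma> \<partial>\<Gamma>) = 0"
    using int score_bounds scores_local[OF *] by (auto intro!: integral_score_mult_eq_0)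
  then show ?thesis
    using i[OF int(1)] i[OF int(2)] by (simp add: score_def[of w] right_diff_distrib)
qed

lemma integral_single:
  "(\<integral>\<gamma>. single v \<gamma> \<partial>\<Gamma>) = (\<integral>\<gamma>. single 0 \<gamma> \<partial>\<Gamma>)"
proof -
  have "(+) v -` ball v r = ball 0 r" by (auto simp: dist_norm)
  then have s: "single v ((+) v ` \<gamma>) = single 0 \<gamma>" for \<gamma>
    by (simp add: single_def screen_translate num_points_translate)
  have "(\<integral>\<gamma>. single v \<gamma> \<partial>\<Gamma>) = (\<integral>\<gamma>. single v \<gamma> \<partial>distr \<Gamma> config_space (\<lambda>\<gamma>. (+) v ` \<gamma>))"
    using stationary by (simp add: stationary_def)
  also have "\<dots> = (\<integral>\<gamma>. single v ((+) v ` \<gamma>) \<partial>\<Gamma>)"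
    using measurable_translate_config by (intro integral_distr) (auto cong: measurable_cong_sets)
  finally show ?thesis by (simp add: s)
qed

lemma integral_single_pos: "0 < (\<integral>\<gamma>. single 0 \<gamma> \<partial>\<Gamma>)"
proof (rule ccontr)
  assume "\<not> 0 < (\<integral>\<gamma>. single 0 \<gamma> \<partial>\<Gamma>)"
  moreover have "0 \<le> (\<integral>\<gamma>. single 0 \<gamma> \<partial>\<Gamma>)" using score_bounds by simp
  ultimately have "(\<integral>\<gamma>. single 0 \<gamma> \<partial>\<Gamma>) = 0" by simp
  moreover have "integrable \<Gamma> (single 0)"
    using integrable_mult_bounded[of "single 0" "\<lambda>_. 1"] score_bounds by auto
  ultimately have "AE \<gamma> in \<Gamma>. single 0 \<gamma> = 0"
    using score_bounds by (simp add: integral_nonneg_eq_0_iff_AE)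
  then have "AE \<gamma> in \<Gamma>. \<not> (num_points (ball 0 r) \<gamma> = 1 \<and> screen 0 \<gamma>)"
    by eventually_elim (auto simp: single_def)
  then show False using possible by simp
qed

text \<open>
  The points of \<open>L\<close> outside the core form a count that ignores the core, so it is orthogonal to the
  score. Inside the core, the count is \<open>1\<close> where the score is positive and \<open>0\<close> where it is negative.
\<close>

lemma integral_count_score:
  assumes L: "L \<in> sets borel" "ball v r \<subseteq> L" and bd: "bounded L"
    and int: "integrable \<Gamma> (\<lambda>\<gamma>. enn2real (num_points L \<gamma>))"
  shows "(\<integral>\<gamma>. (enn2real (num_points L \<gamma>) - c) * score v \<gamma> \<partial>\<Gamma>) = (\<integral>\<gamma>. single 0 \<gamma> \<partial>\<Gamma>)"
proof -
  note [measurable] = L(1)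
  define G where "G \<gamma> = enn2real (num_points (L - ball v r) \<gamma>)" for \<gamma>
  have split: "enn2real (num_points L \<gamma>) = enn2real (num_points (ball v r) \<gamma>) + G \<gamma>"
    if "\<gamma> \<in> locally_finite_sets" for \<gamma>
  proof -
    have fin: "finite (\<gamma> \<inter> L)" "finite (\<gamma> \<inter> ball v r)" "finite (\<gamma> \<inter> (L - ball v r))"
      using bd that by (auto intro!: finite_locally_finite_Int)
    have "\<gamma> \<inter> L = (\<gamma> \<inter> ball v r) \<union> (\<gamma> \<inter> (L - ball v r))" using L(2) by auto
    moreover have "card ((\<gamma> \<inter> ball v r) \<union> (\<gamma> \<inter> (L - ball v r))) = card (\<gamma> \<inter> ball v r) + card (\<gamma> \<inter> (L - ball v r))"
      using fin by (intro card_Un_disjoint) auto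
    ultimately have "card (\<gamma> \<inter> L) = card (\<gamma> \<inter> ball v r) + card (\<gamma> \<inter> (L - ball v r))" by simp
    then show ?thesis
      unfolding G_def num_points_eq_card[OF fin(1)] num_points_eq_card[OF fin(2)] num_points_eq_card[OF fin(3)]
      by (metis enn2real_of_nat of_nat_add)
  qed
  have G_int: "integrable \<Gamma> G"
  proof (rule Bochner_Integration.integrable_bound[OF int])
    show "G \<in> borel_measurable \<Gamma>" unfolding G_def by measurable
    show "AE \<gamma> in \<Gamma>. norm (G \<gamma>) \<le> norm (enn2real (num_points L \<gamma>))"
      using AE_space by eventually_elim (simp add: split, simp add: G_def)
  qed
  have G_inv: "G (\<gamma> - ball v r) = G \<gamma>" for \<gamma>
    unfolding G_def by (intro arg_cong[of _ _ enn2real] num_points_cong) auto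
  have point: "(enn2real (num_points L \<gamma>) - c) * score v \<gamma> = single v \<gamma> + score v \<gamma> * G \<gamma> - c * score v \<gamma>"
    if "\<gamma> \<in> space \<Gamma>" for \<gamma>
  proof -
    have "enn2real (num_points (ball v r) \<gamma>) * score v \<gamma> = single v \<gamma>"
      by (auto simp: score_def single_def vacant_def)
    then show ?thesis using split that by (simp add: algebra_simps)
  qed
  have i: "integrable \<Gamma> (\<lambda>\<gamma>. score v \<gamma> * f \<gamma>)" if "integrable \<Gamma> f" for f
    unfolding score_def left_diff_distrib
    using that score_bounds by (auto intro!: integrable_mult_bounded)
  have s: "integrable \<Gamma> (single v)"
    using integrable_mult_bounded[of "single v" "\<lambda>_. 1"] score_bounds by auto
  have p: "integrable \<Gamma> (score v)" using i[of "\<lambda>_. 1"] by simp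
  have "(\<integral>\<gamma>. (enn2real (num_points L \<gamma>) - c) * score v \<gamma> \<partial>\<Gamma>)
      = (\<integral>\<gamma>. single v \<gamma> + score v \<gamma> * G \<gamma> - c * score v \<gamma> \<partial>\<Gamma>)"
    by (intro Bochner_Integration.integral_cong point refl)
  also have "\<dots> = (\<integral>\<gamma>. single v \<gamma> \<partial>\<Gamma>) + (\<integral>\<gamma>. score v \<gamma> * G \<gamma> \<partial>\<Gamma>) - c * (\<integral>\<gamma>. score v \<gamma> \<partial>\<Gamma>)"
    using s p i[OF G_int] by simp
  also have "(\<integral>\<gamma>. score v \<gamma> * G \<gamma> \<partial>\<Gamma>) = 0"
    by (rule integral_score_mult_eq_0[OF G_int _ G_inv]) (simp add: G_def)
  finally show ?thesis by (simp add: integral_score_eq_0 integral_single[of v])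
qed

text \<open>
  If the variance is finite, the count is integrable, so that its Bochner integral is its true mean
  and the bound for orthogonal variables applies to the centred count.
\<close>

lemma count_variance_ge:
  assumes L: "L \<in> sets borel" "bounded L" and V: "finite V"
    and sub: "\<And>v. v \<in> V \<Longrightarrow> ball v R \<subseteq> L"
    and disj: "\<And>v w. v \<in> V \<Longrightarrow> w \<in> V \<Longrightarrow> v \<noteq> w \<Longrightarrow> ball v R \<inter> ball w R = {}"
  shows "ennreal (card V * ((\<integral>\<gamma>. single 0 \<gamma> \<partial>\<Gamma>)\<^sup>2 / C\<^sup>2)) \<le> count_variance \<Gamma> L"
proof (cases "count_variance \<Gamma> L = \<top>")
  case False
  note [measurable] = L(1)
  define \<mu> where "\<mu> = (\<integral>\<gamma>. enn2real (num_points L \<gamma>) \<partial>\<Gamma>)"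
  define Y where "Y \<gamma> = enn2real (num_points L \<gamma>) - \<mu>" for \<gamma>
  have Y [measurable]: "Y \<in> borel_measurable \<Gamma>" unfolding Y_def by measurable
  have var: "count_variance \<Gamma> L = (\<integral>\<^sup>+\<gamma>. ennreal ((Y \<gamma>)\<^sup>2) \<partial>\<Gamma>)"
    by (simp add: count_variance_def Y_def \<mu>_def)
  have Y2: "integrable \<Gamma> (\<lambda>\<gamma>. (Y \<gamma>)\<^sup>2)"
    using False by (intro integrableI_nonneg) (auto simp: var less_top)
  have "integrable \<Gamma> Y" using square_integrable_imp_integrable[OF Y Y2] .
  then have "integrable \<Gamma> (\<lambda>\<gamma>. Y \<gamma> + \<mu>)" by simp
  then have int: "integrable \<Gamma> (\<lambda>\<gamma>. enn2real (num_points L \<gamma>))" by (simp add: Y_def)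
  have "card V * ((\<integral>\<gamma>. single 0 \<gamma> \<partial>\<Gamma>)\<^sup>2 / C\<^sup>2) \<le> (\<integral>\<gamma>. (Y \<gamma>)\<^sup>2 \<partial>\<Gamma>)"
  proof (rule second_moment_ge_orthogonal[OF V Y Y2, where \<psi> = score])
    show "\<bar>score v \<gamma>\<bar> \<le> C" for v \<gamma>
      using score_bounds[of v \<gamma>] by (simp add: score_def abs_le_iff)
    show "0 < C" using C_ge by simp
    show "(\<integral>\<gamma>. score v \<gamma> * score w \<gamma> \<partial>\<Gamma>) = 0" if "v \<in> V" "w \<in> V" "v \<noteq> w" for v w
      using disj[OF that] by (rule scores_orthogonal)
    show "(\<integral>\<gamma>. Y \<gamma> * score v \<gamma> \<partial>\<Gamma>) = (\<integral>\<gamma>. single 0 \<gamma> \<partial>\<Gamma>)" if "v \<in> V" for v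
    proof -
      have "ball v r \<subseteq> ball v R" using radii by auto
      then show ?thesis unfolding Y_def
        using sub[OF that] by (intro integral_count_score L int) auto
    qed
  qed (auto cong: measurable_cong_sets)
  then show ?thesis
    unfolding var using Y2 by (simp add: nn_integral_eq_integral ennreal_leI)
qed simp

text \<open>
  Cubes with centre \<open>0\<close> already violate hyperuniformity: along them the ratio of variance and volume is
  bounded below by the constant \<open>\<delta>\<close>, since the number of disjoint neighbourhoods is exactly
  the volume divided by that of a tile.
\<close>

theorem not_hyperuniform: "\<not> hyperuniform \<Gamma>"
proof
  assume hyp: "hyperuniform \<Gamma>"
  define L :: "nat \<Rightarrow> 'a set" where "L n = cube ((2 * real n + 1) * R)" for n
  define \<delta> where "\<delta> = (\<integral>\<gamma>. single 0 \<gamma> \<partial>\<Gamma>)\<^sup>2 / C\<^sup>2 / (2 * R) ^ DIM('a)"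
  have "0 < R" using radii by simp
  have "0 < \<delta>" using integral_single_pos \<open>0 < R\<close> C_ge by (simp add: \<delta>_def)
  have "incseq L"
  proof (rule incseq_SucI)
    fix n
    have "(2 * real n + 1) * R \<le> (2 * real (Suc n) + 1) * R" using \<open>0 < R\<close> by simp
    then show "L n \<subseteq> L (Suc n)" by (force simp: L_def mem_cube_iff)
  qed
  moreover have "(\<Union>n. L n) = UNIV"
  proof (intro set_eqI iffI UNIV_I)
    fix x :: 'a
    obtain n :: nat where "norm x / R < real n" using reals_Archimedean2 by blast
    then have "norm x < real n * R" using \<open>0 < R\<close> by (simp add: divide_less_eq)
    also have "\<dots> \<le> (2 * real n + 1) * R" using \<open>0 < R\<close> by (intro mult_right_mono) auto
    finally have "\<bar>x \<bullet> b\<bar> \<le> (2 * real n + 1) * R" if "b \<in> Basis" for b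
      using Basis_le_norm[OF that, of x] by linarith
    then have "x \<in> L n" by (simp add: L_def mem_cube_iff)
    then show "x \<in> (\<Union>n. L n)" by blast
  qed
  ultimately have lim: "(\<lambda>n. count_variance \<Gamma> (L n) / emeasure lborel (L n)) \<longlonglongrightarrow> 0"
    using hyp by (auto simp: hyperuniform_def L_def cube_def)
  have "ennreal \<delta> \<le> count_variance \<Gamma> (L n) / emeasure lborel (L n)" for n
  proof -
    obtain V :: "'a set" where V: "finite V" "emeasure lborel (L n) = ennreal (card V * (2 * R) ^ DIM('a))"
      "0 < card V" "\<And>v. v \<in> V \<Longrightarrow> ball v R \<subseteq> L n"
      "\<And>v w. v \<in> V \<Longrightarrow> w \<in> V \<Longrightarrow> v \<noteq> w \<Longrightarrow> ball v R \<inter> ball w R = {}"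
      using cube_packing[OF \<open>0 < R\<close>, of n] unfolding L_def by metis
    have vol: "0 < card V * (2 * R) ^ DIM('a)" using V(3) \<open>0 < R\<close> by simp
    have "ennreal \<delta> = ennreal (card V * ((\<integral>\<gamma>. single 0 \<gamma> \<partial>\<Gamma>)\<^sup>2 / C\<^sup>2)) / emeasure lborel (L n)"
      unfolding V(2) using vol V(3) by (subst divide_ennreal) (auto simp: \<delta>_def)
    also have "\<dots> \<le> count_variance \<Gamma> (L n) / emeasure lborel (L n)"
      by (intro divide_right_mono_ennreal count_variance_ge V) (simp_all add: L_def cube_def)
    finally show ?thesis .
  qed
  then have "ennreal \<delta> \<le> 0"
    by (intro LIMSEQ_le_const[OF lim]) auto
  then show False using \<open>0 < \<delta>\<close> by simp
qed

end

section \<open>The nearest-neighbour model\<close>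

lemma pred_screened [measurable]:
  "finite T \<Longrightarrow> Measurable.pred config_space (screened T k K v)"
  unfolding screened_def by measurable

text \<open>
  The balls around the points of the net lie at distance more than \<open>4\<close> and less than \<open>6\<close> from \<open>v\<close>, hence
  between the core and the boundary of the neighbourhood.
\<close>

lemma screened_local:
  assumes "T \<subseteq> sphere 0 5" and eq: "\<gamma> \<inter> (ball v 16 - ball v 1) = \<gamma>' \<inter> (ball v 16 - ball v 1)"
  shows "screened T k K v \<gamma> \<longleftrightarrow> screened T k K v \<gamma>'"
proof -
  have "num_points (ball (v + p) 1) \<gamma> = num_points (ball (v + p) 1) \<gamma>'" if "p \<in> T" for p
  proof (rule num_points_cong)
    have p: "norm p = 5" using assms(1) that by auto
    have "ball (v + p) 1 \<subseteq> ball v 16 - ball v 1"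
    proof
      fix s assume "s \<in> ball (v + p) 1"
      moreover have "dist v s \<le> 5 + dist (v + p) s" "5 \<le> dist v s + dist (v + p) s"
        using dist_triangle[of v s "v + p"] dist_triangle[of v "v + p" s] p
        by (simp_all add: dist_norm norm_minus_commute)
      ultimately show "s \<in> ball v 16 - ball v 1" by simp
    qed
    then show "\<gamma> \<inter> ball (v + p) 1 = \<gamma>' \<inter> ball (v + p) 1" using eq by blast
  qed
  then show ?thesis using num_points_cong[OF eq] by (simp add: screened_def)
qed

lemma vimage_translate_ball: "(+) v -` ball (v + p) r = ball (p :: 'a::real_normed_vector) r"
  by (auto simp: dist_norm)

lemma screened_translate: "screened T k K v ((+) v ` \<gamma>) \<longleftrightarrow> screened T k K 0 \<gamma>"
  using vimage_translate_ball[of v 0]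
  by (simp add: screened_def num_points_translate vimage_Diff vimage_translate_ball)

text \<open>
  The restriction to \<open>ball v 16\<close> makes this a function of the points in the neighbourhood for every
  configuration; for screened ones it agrees with the integral of the true intensity.
\<close>

definition screened_mass ::
    "nat \<Rightarrow> real \<Rightarrow> real \<Rightarrow> (real ^ 'n::{finite,linorder} \<Rightarrow> real) \<Rightarrow> real ^ 'n::{finite,linorder} \<Rightarrow> (real ^ 'n::{finite,linorder}) set \<Rightarrow> ennreal" where
  "screened_mass k z \<beta> \<Phi> v \<gamma> =
     (\<integral>\<^sup>+x\<in>ball v 1. ennreal (z * exp (- \<beta> * local_energy k \<Phi> x (\<gamma> \<inter> ball v 16))) \<partial>lborel)"

lemma screened_mass_measurable [measurable]:
  assumes [measurable]: "\<Phi> \<in> borel_measurable borel"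
  shows "screened_mass k z \<beta> \<Phi> v \<in> borel_measurable config_space"
proof -
  have [measurable]: "Measurable.pred (config_space \<Otimes>\<^sub>M borel) (\<lambda>p. snd p \<in> ball v 1)"
    by (rule pred_sets2[of _ borel]) auto
  show ?thesis unfolding screened_mass_def by measurable
qed

lemma screened_mass_eq:
  fixes v :: "real ^ 'n::{finite,linorder}"
  assumes "\<gamma> \<in> locally_finite_sets" "screened T k K v \<gamma>"
    and "T \<subseteq> sphere 0 5" "sphere 0 5 \<subseteq> (\<Union>p\<in>T. ball p 1)"
  shows "(\<integral>\<^sup>+x\<in>ball v 1. ennreal (z * exp (- \<beta> * local_energy k \<Phi> x \<gamma>)) \<partial>lborel) = screened_mass k z \<beta> \<Phi> v \<gamma>"
  unfolding screened_mass_def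
proof (rule nn_integral_cong)
  fix x
  show "ennreal (z * exp (- \<beta> * local_energy k \<Phi> x \<gamma>)) * indicator (ball v 1) x
      = ennreal (z * exp (- \<beta> * local_energy k \<Phi> x (\<gamma> \<inter> ball v 16))) * indicator (ball v 1) x"
    using local_energy_screened[OF assms, of x] by (cases "x \<in> ball v 1") simp_all
qed

lemma screened_mass_le:
  fixes v :: "real ^ 'n::{finite,linorder}"
  assumes lf: "\<gamma> \<in> locally_finite_sets" and scr: "screened T k K v \<gamma>"
    and vac: "num_points (ball v 1) \<gamma> = 0"
    and M: "\<And>u. \<bar>\<Phi> u\<bar> \<le> M" and "0 \<le> \<beta>" "0 \<le> z"
  shows "screened_mass k z \<beta> \<Phi> v \<gamma> \<le> ennreal (z * exp (\<beta> * (3 * M * K)) * unit_ball_vol CARD('n))"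
proof -
  let ?c = "z * exp (\<beta> * (3 * M * K))"
  have M0: "0 \<le> M" using M[of 0] by linarith
  have fin: "finite (\<gamma> \<inter> ball v 16)" using lf by (rule finite_locally_finite_Int) simp
  have ring: "\<gamma> \<inter> (ball v 16 - ball v 1) = \<gamma> \<inter> ball v 16"
    using vac by (auto simp: num_points_eq_0_iff)
  have "num_points (ball v 16 - ball v 1) \<gamma> \<le> of_nat K" using scr by (simp add: screened_def)
  then have card: "card (\<gamma> \<inter> ball v 16) \<le> K"
    using fin by (simp add: num_points_eq_card ring)
  have le: "z * exp (- \<beta> * local_energy k \<Phi> x (\<gamma> \<inter> ball v 16)) \<le> ?c" for x
  proof -
    have "\<bar>local_energy k \<Phi> x (\<gamma> \<inter> ball v 16)\<bar> \<le> 3 * M * card (\<gamma> \<inter> ball v 16)"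
      by (rule abs_local_energy_le[OF fin M])
    also have "\<dots> \<le> 3 * M * K" using card M0 by (intro mult_left_mono) auto
    finally have "- local_energy k \<Phi> x (\<gamma> \<inter> ball v 16) \<le> 3 * M * K" by linarith
    from mult_left_mono[OF this \<open>0 \<le> \<beta>\<close>] show ?thesis
      using \<open>0 \<le> z\<close> by (intro mult_left_mono) simp_all
  qed
  have "screened_mass k z \<beta> \<Phi> v \<gamma> \<le> (\<integral>\<^sup>+x. ennreal ?c * indicator (ball v 1) x \<partial>lborel)"
    unfolding screened_mass_def using le
    by (intro nn_integral_mono mult_right_mono ennreal_leI) auto
  also have "\<dots> = ennreal ?c * emeasure lborel (ball v 1)"
    by (rule nn_integral_cmult_indicator) simp
  also have "\<dots> = ennreal (?c * unit_ball_vol CARD('n))"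
    using \<open>0 \<le> z\<close> by (subst emeasure_ball) (simp_all add: ennreal_mult)
  finally show ?thesis .
qed

lemma emeasure_ball_neq_0:
  fixes c :: "'a::euclidean_space"
  assumes "0 < r" shows "emeasure lborel (ball c r) \<noteq> 0"
proof -
  have "unit_ball_vol (real DIM('a)) \<noteq> 0"
    using unit_ball_vol_pos[of "real DIM('a)"] by linarith
  then show ?thesis using assms by (simp add: emeasure_ball)
qed

text \<open>
  The multiset contains each ball of the net \<open>k + 1\<close> times. Once these balls are filled and the core is still
  empty, one more point is put into the core, which leaves the screening intact.
\<close>

lemma (in gibbs_with_intensity) possibly_single_screened:
  assumes T: "finite T" "T \<subseteq> sphere 0 5"
  shows "\<exists>K. \<not> (AE \<gamma> in \<Gamma>. \<not> (num_points (ball 0 1) \<gamma> = 1 \<and> screened T k K 0 \<gamma>))"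
proof -
  define M where "M = repeat_mset (Suc k) (mset_set ((\<lambda>p. ball p 1) ` T))"
  have M: "U \<in> sets borel \<and> U \<inter> ball 0 1 = {} \<and> emeasure lborel U \<noteq> 0" if "U \<in># M" for U :: "'a set"
  proof -
    have "count M U = Suc k * count (mset_set ((\<lambda>p. ball p 1) ` T)) U" by (simp add: M_def)
    then have "U \<in># mset_set ((\<lambda>p. ball p 1) ` T)"
      using that by (metis count_eq_zero_iff mult_0_right)
    then obtain p where p: "p \<in> T" "U = ball p 1" using T(1) by auto
    have "norm p = 5" using p T(2) by auto
    then have "ball p 1 \<inter> ball 0 1 = {}" by (intro disjoint_ballI) simp
    moreover have "emeasure lborel (ball p 1) \<noteq> 0"
      by (simp add: emeasure_ball_neq_0)
    ultimately show ?thesis by (simp add: p)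
  qed
  obtain n :: nat where n: "\<not> (AE \<gamma> in \<Gamma>. \<not> (num_points (ball 0 16) \<gamma> \<le> of_nat n \<and> num_points (ball 0 1) \<gamma> = 0 \<and>
      (\<forall>U\<in>#M. of_nat (count M U) \<le> num_points U \<gamma>)))"
    using possibly_crowded[OF _ _ _ subset_ball[of 1 16], of 0 M] M by auto
  have [measurable]: "U \<in> sets borel" if "U \<in># M" for U using M[OF that] by simp
  have E: "Measurable.pred config_space (\<lambda>\<gamma>. num_points (ball 0 16) \<gamma> \<le> of_nat n \<and> num_points (ball 0 1) \<gamma> = 0 \<and>
      (\<forall>U\<in>#M. of_nat (count M U) \<le> num_points U \<gamma>))"
    by measurable
  have E': "Measurable.pred config_space (\<lambda>\<gamma>. num_points (ball 0 1) \<gamma> = 1 \<and> screened T k n 0 \<gamma>)"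
    using T(1) by measurable
  show ?thesis
  proof (intro exI notI)
    assume never: "AE \<gamma> in \<Gamma>. \<not> (num_points (ball 0 1) \<gamma> = 1 \<and> screened T k n 0 \<gamma>)"
    have "AE \<gamma> in \<Gamma>. \<not> (num_points (ball 0 16) \<gamma> \<le> of_nat n \<and> num_points (ball 0 1) \<gamma> = 0 \<and>
      (\<forall>U\<in>#M. of_nat (count M U) \<le> num_points U \<gamma>))"
    proof (rule possible_add_point[OF E E' _ _ _ never])
      show "ball 0 1 \<in> sets (borel :: 'a measure)" "emeasure lborel (ball (0::'a) 1) \<noteq> 0"
        by (simp_all add: emeasure_ball_neq_0)
      fix \<gamma> x assume g: "\<gamma> \<in> locally_finite_sets"
        and h: "num_points (ball 0 16) \<gamma> \<le> of_nat n \<and> num_points (ball 0 1) \<gamma> = 0 \<and>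
          (\<forall>U\<in>#M. of_nat (count M U) \<le> num_points U \<gamma>)"
        and x: "x \<in> ball 0 1" "x \<notin> \<gamma>"
      have one: "num_points (ball 0 1) (insert x \<gamma>) = 1"
        unfolding num_points_insert[OF x(2)] using h x(1) by simp
      have ring_eq: "\<gamma> \<inter> (ball 0 16 - ball 0 1) = \<gamma> \<inter> ball 0 16"
        using h by (auto simp: num_points_eq_0_iff)
      have "num_points (ball 0 16 - ball 0 1) (insert x \<gamma>) = num_points (ball 0 16 - ball 0 1) \<gamma>"
        unfolding num_points_insert[OF x(2)] using x(1) by simp
      also have "\<dots> = num_points (ball 0 16) \<gamma>"
        by (simp add: num_points_def ring_eq)
      also have "\<dots> \<le> of_nat n" using h by simp
      finally have ring: "num_points (ball 0 16 - ball 0 1) (insert x \<gamma>) \<le> of_nat n" .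
      have "of_nat (Suc k) \<le> num_points (ball (0 + p) 1) (insert x \<gamma>)" if "p \<in> T" for p
      proof -
        have "count M (ball p 1) = Suc k" using that T(1) by (simp add: M_def)
        moreover from this have "ball p 1 \<in># M" by (metis count_eq_zero_iff nat.distinct(1))
        ultimately have "of_nat (Suc k) \<le> num_points (ball p 1) \<gamma>" using h by metis
        also have "\<dots> \<le> num_points (ball p 1) (insert x \<gamma>)"
          by (simp add: num_points_insert[OF x(2)])
        finally show ?thesis by simp
      qed
      then show "num_points (ball 0 1) (insert x \<gamma>) = 1 \<and> screened T k n 0 (insert x \<gamma>)"
        using one ring by (simp add: screened_def)
    qed
    then show False using n by simp
  qed
qed

theorem corollary6:
  fixes k :: nat and z \<beta> :: real
    and \<Phi> :: "real ^ 'n::{finite,linorder} \<Rightarrow> real"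
    and \<Gamma> :: "(real ^ 'n::{finite,linorder}) set measure"
  assumes "k \<ge> 1" and "z > 0" and "\<beta> \<ge> 0"
    and "\<Phi> \<in> borel_measurable borel" and "bounded (range \<Phi>)"
    and "stationary \<Gamma>"
    and "gibbs_process \<Gamma> (\<lambda>x \<gamma>. ennreal (z * exp (- \<beta> * local_energy k \<Phi> x \<gamma>)))"
  shows "\<not> hyperuniform \<Gamma>"
proof -
  let ?lam = "\<lambda>x \<gamma>. ennreal (z * exp (- \<beta> * local_energy k \<Phi> x \<gamma>))"
  note [measurable] = assms(4)
  have lam: "(\<lambda>(x, \<gamma>). ?lam x \<gamma>) \<in> borel_measurable (borel \<Otimes>\<^sub>M config_space)"
    unfolding case_prod_beta' by measurable
  interpret gibbs_with_intensity \<Gamma> ?lam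
    using assms(2,7) lam by unfold_locales auto
  obtain M where M: "\<And>u. \<bar>\<Phi> u\<bar> \<le> M"
    using assms(5) by (auto simp: bounded_iff)
  obtain T :: "(real ^ 'n::{finite,linorder}) set" where
    T: "finite T" "T \<subseteq> sphere 0 5" "sphere 0 5 \<subseteq> (\<Union>p\<in>T. ball p 1)"
    using seq_compact_imp_totally_bounded[of "sphere 0 5 :: (real ^ 'n::{finite,linorder}) set"]
      compact_sphere[of "0 :: real ^ 'n::{finite,linorder}" 5] zero_less_one
    unfolding compact_eq_seq_compact_metric by metis
  obtain K where K: "\<not> (AE \<gamma> in \<Gamma>. \<not> (num_points (ball 0 1) \<gamma> = 1 \<and> screened T k K 0 \<gamma>))"
    using possibly_single_screened[OF T(1,2)] by blast
  define C where "C = max 1 (z * exp (\<beta> * (3 * M * K)) * unit_ball_vol CARD('n))"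
  interpret local_intensity_model \<Gamma> ?lam 1 16 C "screened T k K" "screened_mass k z \<beta> \<Phi>"
  proof unfold_locales
    fix v and \<gamma> :: "(real ^ 'n::{finite,linorder}) set"
    assume g: "\<gamma> \<in> locally_finite_sets" and scr: "screened T k K v \<gamma>"
      and vac: "num_points (ball v 1) \<gamma> = 0"
    have "screened_mass k z \<beta> \<Phi> v \<gamma> \<le> ennreal (z * exp (\<beta> * (3 * M * K)) * unit_ball_vol CARD('n))"
      using screened_mass_le[OF g scr vac M] assms(2,3) by simp
    also have "\<dots> \<le> ennreal C" by (intro ennreal_leI) (simp add: C_def)
    finally show "(\<integral>\<^sup>+x\<in>ball v 1. ?lam x \<gamma> \<partial>lborel) = screened_mass k z \<beta> \<Phi> v \<gamma> \<and>
        screened_mass k z \<beta> \<Phi> v \<gamma> \<le> ennreal C"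
      using screened_mass_eq[OF g scr T(2,3)] by simp
  next
    show "screened_mass k z \<beta> \<Phi> v \<gamma> = screened_mass k z \<beta> \<Phi> v \<gamma>'"
      if "\<gamma> \<inter> ball v 16 = \<gamma>' \<inter> ball v 16" for v and \<gamma> \<gamma>' :: "(real ^ 'n::{finite,linorder}) set"
      by (simp add: screened_mass_def that)
    show "screened T k K v \<gamma> \<longleftrightarrow> screened T k K v \<gamma>'"
      if "\<gamma> \<inter> (ball v 16 - ball v 1) = \<gamma>' \<inter> (ball v 16 - ball v 1)" for v \<gamma> \<gamma>'
      using T(2) that by (rule screened_local)
  qed (use T(1) assms(4,6) K in \<open>auto simp: C_def screened_translate\<close>)
  show ?thesis by (rule not_hyperuniform)
qed

end
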